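(* Let $X_1,X_2,\dots$ be random variables such that for each $i\ge1$, $X_i\in\mathcal H_i$, $X_i$ is independent of $\mathcal F_{i-1}$, all $X_i$ are identically distributed, and $$\sum_{m=1}^\infty\mathcal E\big(|X_1|I_{\{m-1<|X_1|\le m\}}\big)<\infty.$$ Let $S_n:=X_1+\cdots+X_n$. Then: (i) if $\mathcal E(X_1)=-\mathcal E(-X_1)$, then $S_n/n\to\mathcal E(X_1)$ quasi-surely; (ii) if $S_n/n$ converges quasi-surely to some $X\in\mathcal H$ and Assumption (A) holds, then $\mathcal E(X_1)=-\mathcal E(-X_1)$ and $X=\mathcal E(X_1)$ q.s.
   Context: Standing setting. $(\Omega,\mathcal F)$ is a measurable space with a discrete-time filtration $(\mathcal F_t)_{t\in\mathbb N}$, $\mathcal F_0$ trivial and $\mathcal F=\sigma(\bigcup_t\mathcal F_t)$. $\mathcal H$ is a linear space of $\mathcal F$-measurable real functions on $\Omega$ containing the constants, such that $X\in\mathcal H$ implies $|X|\in\mathcal H$ and $I_AX\in\mathcal H$ for all $A\in\mathcal F$; $\mathcal H_t:=\{X\in\mathcal H: X \text{ is } \mathcal F_t\text{-measurable}\}$. $(\mathcal E_t)$ is an $\mathcal{SL}$-expectation (a family of maps $\mathcal E_t:\mathcal H\to\mathcal H_t$ that are monotone, time-consistent $\mathcal E_s\circ\mathcal E_t=\mathcal E_s$ for $s\le t$, satisfy $\mathcal E_t(I_AY)=I_A\mathcal E_t(Y)$ for $A\in\mathcal F_t$, $\mathcal E_t(Y)=Y$ for $Y\in\mathcal H_t$,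 are subadditive, satisfy $\mathcal E_t(\lambda Y)=\lambda^+\mathcal E_t(Y)+\lambda^-\mathcal E_t(-Y)$ for $\lambda\in\mathcal H_t$, and $\mathcal E_0(X_i)\to0$ whenever $X_i\downarrow0$ pointwise); $\mathcal E:=\mathcal E_0$; $\mathbb V(A):=\mathcal E(I_A)$. "Quasi-surely" (q.s.) means outside a set $N$ with $\mathcal E(I_N)=0$. Independence: $Y\in\mathcal H$ is independent of $Z=(Z_1,\dots,Z_k)$ under $\mathcal E$ if for every measurable $\varphi$ with $\varphi(Z,Y)\in\mathcal H$ and $\varphi(z,Y)\in\mathcal H$ for all $z$, $\mathcal E[\varphi(Z,Y)]=\mathcal E[\bar\varphi(Z)]$ with $\bar\varphi(z):=\mathcal E[\varphi(z,Y)]$; $X$ is independent of $\mathcal F_n$ if $X$ is independent of $I_A$ for every $A\in\mathcal F_n$. $X,Y$ are identically distributed if $\mathcal E[\varphi(X)]=\mathcal E[\varphi(Y)]$ for every $\varphi$ with $\varphi(X),\varphi(Y)\in\mathcal H$. Assumption (A): for any sequence $(Y_n)_{n\in\mathbb N}$ of random variables and any $B\in\sigma(Y_n,n\in\mathbb N)$ there exist $B_n\in\sigma(Y_1,\dots,Y_n)$ with $\lim_{n\to\infty}\mathbb V(B_n\triangle B)=0$, where $B_n\triangle B=(B_n\setminus B)\cup(B\setminus B_n)$. *)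

theory Defs
  imports "HOL-Analysis.Analysis"
begin

definition filtration_std :: "'a measure \<Rightarrow> (nat \<Rightarrow> 'a measure) \<Rightarrow> bool" where
  "filtration_std M F \<longleftrightarrow>
     space M = UNIV \<and>
     (\<forall>t. space (F t) = UNIV \<and> sets (F t) \<subseteq> sets M) \<and>
     (\<forall>s t. s \<le> t \<longrightarrow> sets (F s) \<subseteq> sets (F t)) \<and>
     sets (F 0) = {{}, UNIV} \<and>
     sets M = sigma_sets UNIV (\<Union>t. sets (F t))"

definition admissible_space :: "'a measure \<Rightarrow> ('a \<Rightarrow> real) set \<Rightarrow> bool" where
  "admissible_space M H \<longleftrightarrow>
     H \<subseteq> borel_measurable M \<and>
     (\<forall>X\<in>H. \<forall>Y\<in>H. (\<lambda>\<omega>. X \<omega> + Y \<omega>) \<in> H) \<and>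
     (\<forall>X\<in>H. \<forall>c::real. (\<lambda>\<omega>. c * X \<omega>) \<in> H) \<and>
     (\<forall>c::real. (\<lambda>_. c) \<in> H) \<and>
     (\<forall>X\<in>H. (\<lambda>\<omega>. \<bar>X \<omega>\<bar>) \<in> H) \<and>
     (\<forall>X\<in>H. \<forall>A\<in>sets M. (\<lambda>\<omega>. indicator A \<omega> * X \<omega>) \<in> H)"

definition Ht :: "('a \<Rightarrow> real) set \<Rightarrow> (nat \<Rightarrow> 'a measure) \<Rightarrow> nat \<Rightarrow> ('a \<Rightarrow> real) set" where
  "Ht H F t = {X \<in> H. X \<in> borel_measurable (F t)}"

definition SL_expectation ::
  "'a measure \<Rightarrow> (nat \<Rightarrow> 'a measure) \<Rightarrow> ('a \<Rightarrow> real) set \<Rightarrow> (nat \<Rightarrow> ('a \<Rightarrow> real) \<Rightarrow> ('a \<Rightarrow> real)) \<Rightarrow> bool" where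
  "SL_expectation M F H E \<longleftrightarrow>
     filtration_std M F \<and> admissible_space M H \<and>
     (\<forall>t. \<forall>Y\<in>H. E t Y \<in> Ht H F t) \<and>
     (\<forall>t. \<forall>X\<in>H. \<forall>Y\<in>H. (\<forall>\<omega>. X \<omega> \<le> Y \<omega>) \<longrightarrow> (\<forall>\<omega>. E t X \<omega> \<le> E t Y \<omega>)) \<and>
     (\<forall>s t. \<forall>Y\<in>H. s \<le> t \<longrightarrow> E s (E t Y) = E s Y) \<and>
     (\<forall>t. \<forall>A\<in>sets (F t). \<forall>Y\<in>H.
        E t (\<lambda>\<omega>. indicator A \<omega> * Y \<omega>) = (\<lambda>\<omega>. indicator A \<omega> * E t Y \<omega>)) \<and>
     (\<forall>t. \<forall>Y\<in>Ht H F t. E t Y = Y) \<and>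
     (\<forall>t. \<forall>X\<in>H. \<forall>Y\<in>H. \<forall>\<omega>. E t (\<lambda>\<omega>. X \<omega> + Y \<omega>) \<omega> \<le> E t X \<omega> + E t Y \<omega>) \<and>
     (\<forall>t. \<forall>l\<in>Ht H F t. \<forall>Y\<in>H. (\<lambda>\<omega>. l \<omega> * Y \<omega>) \<in> H \<longrightarrow>
        E t (\<lambda>\<omega>. l \<omega> * Y \<omega>) =
          (\<lambda>\<omega>. max (l \<omega>) 0 * E t Y \<omega> + max (- l \<omega>) 0 * E t (\<lambda>\<omega>'. - Y \<omega>') \<omega>)) \<and>
     (\<forall>Xs::nat \<Rightarrow> 'a \<Rightarrow> real. (\<forall>i. Xs i \<in> H) \<and> (\<forall>i \<omega>. Xs (Suc i) \<omega> \<le> Xs i \<omega>) \<and>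
        (\<forall>\<omega>. (\<lambda>i. Xs i \<omega>) \<longlonglongrightarrow> 0) \<longrightarrow> (\<forall>\<omega>. (\<lambda>i. E 0 (Xs i) \<omega>) \<longlonglongrightarrow> 0))"

text \<open>The real number \<E>(X) = E_0(X); E_0(X) is F_0-measurable, hence constant,
so we read it off at an arbitrary point.\<close>
definition expect :: "(nat \<Rightarrow> ('a \<Rightarrow> real) \<Rightarrow> ('a \<Rightarrow> real)) \<Rightarrow> ('a \<Rightarrow> real) \<Rightarrow> real" where
  "expect E X = E 0 X undefined"

definition capacity :: "(nat \<Rightarrow> ('a \<Rightarrow> real) \<Rightarrow> ('a \<Rightarrow> real)) \<Rightarrow> 'a set \<Rightarrow> real" where
  "capacity E A = expect E (indicator A)"

definition quasi_surely ::
  "'a measure \<Rightarrow> (nat \<Rightarrow> ('a \<Rightarrow> real) \<Rightarrow> ('a \<Rightarrow> real)) \<Rightarrow> ('a \<Rightarrow> bool) \<Rightarrow> bool" where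
  "quasi_surely M E P \<longleftrightarrow> (\<exists>N\<in>sets M. capacity E N = 0 \<and> (\<forall>\<omega>. \<omega> \<notin> N \<longrightarrow> P \<omega>))"

definition indep_of ::
  "('a \<Rightarrow> real) set \<Rightarrow> (nat \<Rightarrow> ('a \<Rightarrow> real) \<Rightarrow> ('a \<Rightarrow> real)) \<Rightarrow> ('a \<Rightarrow> real) \<Rightarrow> ('a \<Rightarrow> real) \<Rightarrow> bool" where
  "indep_of H E Y Z \<longleftrightarrow>
     (\<forall>\<phi> :: real \<times> real \<Rightarrow> real. \<phi> \<in> borel_measurable borel \<longrightarrow>
        (\<lambda>\<omega>. \<phi> (Z \<omega>, Y \<omega>)) \<in> H \<longrightarrow> (\<forall>z. (\<lambda>\<omega>. \<phi> (z, Y \<omega>)) \<in> H) \<longrightarrow>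
        expect E (\<lambda>\<omega>. \<phi> (Z \<omega>, Y \<omega>)) =
          expect E (\<lambda>\<omega>. expect E (\<lambda>\<omega>'. \<phi> (Z \<omega>, Y \<omega>'))))"

definition indep_of_Ft ::
  "('a \<Rightarrow> real) set \<Rightarrow> (nat \<Rightarrow> 'a measure) \<Rightarrow> (nat \<Rightarrow> ('a \<Rightarrow> real) \<Rightarrow> ('a \<Rightarrow> real)) \<Rightarrow> ('a \<Rightarrow> real) \<Rightarrow> nat \<Rightarrow> bool" where
  "indep_of_Ft H F E X n \<longleftrightarrow> (\<forall>A\<in>sets (F n). indep_of H E X (indicator A))"

definition ident_distr ::
  "('a \<Rightarrow> real) set \<Rightarrow> (nat \<Rightarrow> ('a \<Rightarrow> real) \<Rightarrow> ('a \<Rightarrow> real)) \<Rightarrow> ('a \<Rightarrow> real) \<Rightarrow> ('a \<Rightarrow> real) \<Rightarrow> bool" where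
  "ident_distr H E X Y \<longleftrightarrow>
     (\<forall>\<phi> :: real \<Rightarrow> real. (\<lambda>\<omega>. \<phi> (X \<omega>)) \<in> H \<longrightarrow> (\<lambda>\<omega>. \<phi> (Y \<omega>)) \<in> H \<longrightarrow>
        expect E (\<lambda>\<omega>. \<phi> (X \<omega>)) = expect E (\<lambda>\<omega>. \<phi> (Y \<omega>)))"

definition gen_sigma :: "('a \<Rightarrow> real) set \<Rightarrow> 'a set set" where
  "gen_sigma Ys = sigma_sets UNIV {Y -` B | Y B. Y \<in> Ys \<and> B \<in> sets borel}"

text \<open>Assumption (A); the sequence Y_1, Y_2, ... is indexed here as Y 0, Y 1, ...,
so that sigma(Y_1,...,Y_n) becomes gen_sigma (Y ` {..<n}).\<close>
definition assumption_A ::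
  "'a measure \<Rightarrow> (nat \<Rightarrow> ('a \<Rightarrow> real) \<Rightarrow> ('a \<Rightarrow> real)) \<Rightarrow> bool" where
  "assumption_A M E \<longleftrightarrow>
     (\<forall>Y :: nat \<Rightarrow> 'a \<Rightarrow> real. (\<forall>n. Y n \<in> borel_measurable M) \<longrightarrow>
       (\<forall>B\<in>gen_sigma (range Y). \<exists>Bs :: nat \<Rightarrow> 'a set.
          (\<forall>n. Bs n \<in> gen_sigma (Y ` {..<n})) \<and>
          (\<lambda>n. capacity E ((Bs n - B) \<union> (B - Bs n))) \<longlonglongrightarrow> 0))"

end

theory Submission
  imports Defs
begin

text \<open>
  Sublinearity and continuity from above of \<open>\<E>\<close> suffice for the one-sided law
  \<open>limsup S\<^sub>n / n \<le> \<E>(X\<^sub>1)\<close> q.s.; (i) follows by applying it to \<open>X\<close> and to \<open>-X\<close>. Products of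
  elements of \<open>H\<close> need not lie in \<open>H\<close>, so the truncated variables are rounded up to a lattice of
  mesh \<open>\<delta>\<close>: all functions in the second moment argument then have finite range. With \<open>U\<^sub>n\<close> the
  partial sums of the rounded and centred variables, \<open>(U\<^sub>n\<^sup>+)\<^sup>2\<close> grows in expectation by at most the
  second moments of the increments, which gives a maximal inequality without conditional
  expectations. The summability assumption bounds the weighted second moments and gives
  \<open>\<bar>X\<^sub>n\<bar> \<le> n\<close> eventually.

  For (ii), \<open>\<E>(X\<^bsub>n+1\<^esub> + Z) \<ge> \<E>(X\<^sub>1) + \<E>(Z)\<close> for \<open>Z\<close> in \<open>H\<^sub>n\<close>; averaging and uniform integrability
  give \<open>\<E>(X + Z) \<ge> \<E>(X\<^sub>1) + \<E>(Z)\<close> for the limit \<open>X\<close>. By Assumption (A) this extends to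
  \<open>Z = (\<E>(X\<^sub>1) - c) I\<^sub>B\<close> with \<open>B = {X < c}\<close> up to a null set. As \<open>X \<le> \<E>(X\<^sub>1)\<close> q.s., the left hand
  side is at most \<open>\<E>(X\<^sub>1)\<close>, so \<open>B\<close> is null. Hence \<open>X = \<E>(X\<^sub>1)\<close> and, by symmetry,
  \<open>-X = \<E>(-X\<^sub>1)\<close> q.s.
\<close>

section \<open>Sublinear expectations and capacities\<close>

lemma finite_range_decomp:
  fixes g :: "'a \<Rightarrow> real"
  assumes "finite (range g)"
  shows "g = (\<lambda>\<omega>. \<Sum>y\<in>range g. y * indicator (g -` {y}) \<omega>)"
proof
  fix \<omega>
  have "(\<Sum>y\<in>range g. y * indicator (g -` {y}) \<omega>) = (\<Sum>y\<in>range g. if y = g \<omega> then y else 0)"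
    by (intro sum.cong) (auto simp: indicator_def)
  also have "\<dots> = g \<omega>" using assms by simp
  finally show "g \<omega> = (\<Sum>y\<in>range g. y * indicator (g -` {y}) \<omega>)" by simp
qed

lemma finite_range_comp2:
  assumes "finite (range f)" "finite (range g)"
  shows "finite (range (\<lambda>\<omega>. h (f \<omega>) (g \<omega>)))"
proof (rule finite_subset)
  show "range (\<lambda>\<omega>. h (f \<omega>) (g \<omega>)) \<subseteq> (\<lambda>(a, b). h a b) ` (range f \<times> range g)" by auto
qed (use assms in auto)

lemma finite_range_comp:
  assumes "finite (range f)"
  shows "finite (range (\<lambda>\<omega>. h (f \<omega>)))"
  using finite_range_comp2[OF assms assms, of "\<lambda>a _. h a"] .

section \<open>Calculus in \<open>H\<close> and for the sublinear expectation\<close>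

locale SL_space =
  fixes M :: "'a measure" and F :: "nat \<Rightarrow> 'a measure" and H :: "('a \<Rightarrow> real) set"
    and E :: "nat \<Rightarrow> ('a \<Rightarrow> real) \<Rightarrow> ('a \<Rightarrow> real)"
  assumes SL: "SL_expectation M F H E"
begin

abbreviation e where "e \<equiv> expect E"
abbreviation V where "V \<equiv> capacity E"

lemma SL_axioms:
  shows filtration: "filtration_std M F" and admissible: "admissible_space M H"
    and E_Ht_all: "\<forall>t. \<forall>Y\<in>H. E t Y \<in> Ht H F t"
    and E_mono_all: "\<forall>t. \<forall>X\<in>H. \<forall>Y\<in>H. (\<forall>\<omega>. X \<omega> \<le> Y \<omega>) \<longrightarrow> (\<forall>\<omega>. E t X \<omega> \<le> E t Y \<omega>)"
    and E_time_all: "\<forall>s t. \<forall>Y\<in>H. s \<le> t \<longrightarrow> E s (E t Y) = E s Y"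
    and E_indicator_all: "\<forall>t. \<forall>A\<in>sets (F t). \<forall>Y\<in>H.
        E t (\<lambda>\<omega>. indicator A \<omega> * Y \<omega>) = (\<lambda>\<omega>. indicator A \<omega> * E t Y \<omega>)"
    and E_id_all: "\<forall>t. \<forall>Y\<in>Ht H F t. E t Y = Y"
    and E_add_all: "\<forall>t. \<forall>X\<in>H. \<forall>Y\<in>H. \<forall>\<omega>. E t (\<lambda>\<omega>. X \<omega> + Y \<omega>) \<omega> \<le> E t X \<omega> + E t Y \<omega>"
    and E_mult_all: "\<forall>t. \<forall>l\<in>Ht H F t. \<forall>Y\<in>H. (\<lambda>\<omega>. l \<omega> * Y \<omega>) \<in> H \<longrightarrow>
        E t (\<lambda>\<omega>. l \<omega> * Y \<omega>) =
          (\<lambda>\<omega>. max (l \<omega>) 0 * E t Y \<omega> + max (- l \<omega>) 0 * E t (\<lambda>\<omega>'. - Y \<omega>') \<omega>)"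
    and E_continuous_all: "\<forall>Xs::nat \<Rightarrow> 'a \<Rightarrow> real. (\<forall>i. Xs i \<in> H) \<and> (\<forall>i \<omega>. Xs (Suc i) \<omega> \<le> Xs i \<omega>) \<and>
        (\<forall>\<omega>. (\<lambda>i. Xs i \<omega>) \<longlonglongrightarrow> 0) \<longrightarrow> (\<forall>\<omega>. (\<lambda>i. E 0 (Xs i) \<omega>) \<longlonglongrightarrow> 0)"
  by (insert SL[unfolded SL_expectation_def], (elim conjE, assumption)+)

lemma space_M [simp]: "space M = UNIV" and space_F [simp]: "space (F t) = UNIV"
  using filtration by (simp_all add: filtration_std_def)

lemma filtration_axioms:
  shows sets_F_subset_all: "\<forall>t. space (F t) = UNIV \<and> sets (F t) \<subseteq> sets M"
    and sets_F_mono_all: "\<forall>s t. s \<le> t \<longrightarrow> sets (F s) \<subseteq> sets (F t)"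
  by (insert filtration[unfolded filtration_std_def], (elim conjE, assumption)+)

lemma sets_F_subset: "sets (F t) \<subseteq> sets M"
  using sets_F_subset_all by blast

lemma sets_F_mono: "s \<le> t \<Longrightarrow> sets (F s) \<subseteq> sets (F t)"
  using sets_F_mono_all by blast

lemma admissible_axioms:
  shows H_subset: "H \<subseteq> borel_measurable M"
    and H_add_all: "\<forall>X\<in>H. \<forall>Y\<in>H. (\<lambda>\<omega>. X \<omega> + Y \<omega>) \<in> H"
    and H_cmult_all: "\<forall>X\<in>H. \<forall>c. (\<lambda>\<omega>. c * X \<omega>) \<in> H"
    and H_const_all: "\<forall>c. (\<lambda>_. c) \<in> H"
    and H_abs_all: "\<forall>X\<in>H. (\<lambda>\<omega>. \<bar>X \<omega>\<bar>) \<in> H"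
    and H_indicator_all: "\<forall>X\<in>H. \<forall>A\<in>sets M. (\<lambda>\<omega>. indicator A \<omega> * X \<omega>) \<in> H"
  by (insert admissible[unfolded admissible_space_def], (elim conjE, assumption)+)

lemma H_measurable: "Y \<in> H \<Longrightarrow> Y \<in> borel_measurable M"
  by (rule subsetD[OF H_subset])

lemma H_add: "Y \<in> H \<Longrightarrow> Z \<in> H \<Longrightarrow> (\<lambda>\<omega>. Y \<omega> + Z \<omega>) \<in> H"
  by (rule H_add_all[rule_format])

lemma H_cmult: "Y \<in> H \<Longrightarrow> (\<lambda>\<omega>. c * Y \<omega>) \<in> H"
  by (rule H_cmult_all[rule_format])

lemma H_const: "(\<lambda>_. c) \<in> H"
  by (rule H_const_all[rule_format])

lemma H_abs: "Y \<in> H \<Longrightarrow> (\<lambda>\<omega>. \<bar>Y \<omega>\<bar>) \<in> H"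
  by (rule H_abs_all[rule_format])

lemma H_indicator_mult: "Y \<in> H \<Longrightarrow> A \<in> sets M \<Longrightarrow> (\<lambda>\<omega>. indicator A \<omega> * Y \<omega>) \<in> H"
  by (rule H_indicator_all[rule_format])

lemma H_mult_indicator: "Y \<in> H \<Longrightarrow> A \<in> sets M \<Longrightarrow> (\<lambda>\<omega>. Y \<omega> * indicator A \<omega>) \<in> H"
  using H_indicator_mult[of Y A] by (simp add: mult.commute)

lemma H_uminus: "Y \<in> H \<Longrightarrow> (\<lambda>\<omega>. - Y \<omega>) \<in> H"
  using H_cmult[of Y "-1"] by simp

lemma H_diff: "Y \<in> H \<Longrightarrow> Z \<in> H \<Longrightarrow> (\<lambda>\<omega>. Y \<omega> - Z \<omega>) \<in> H"
  using H_add[OF _ H_uminus, of Y Z] by simp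

lemma H_divide: "Y \<in> H \<Longrightarrow> (\<lambda>\<omega>. Y \<omega> / c) \<in> H"
  using H_cmult[of Y "1 / c"] by simp

lemma H_sum: "(\<And>i. i \<in> I \<Longrightarrow> Y i \<in> H) \<Longrightarrow> (\<lambda>\<omega>. \<Sum>i\<in>I. Y i \<omega>) \<in> H"
proof (induction I rule: infinite_finite_induct)
  case (insert x I)
  then show ?case using H_add[of "Y x" "\<lambda>\<omega>. \<Sum>i\<in>I. Y i \<omega>"] by simp
qed (simp_all add: H_const)

lemma H_indicator: "A \<in> sets M \<Longrightarrow> indicator A \<in> H"
  using H_indicator_mult[OF H_const[of 1]] by simp

text \<open>A measurable function with finitely many values is a finite combination of indicators of
  its level sets, and these lie in \<open>H\<close>. This is the route by which products and squares
  of simple functions are placed in \<open>H\<close>.\<close>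

lemma H_finite_range:
  assumes "g \<in> borel_measurable M" "finite (range g)"
  shows "g \<in> H"
proof -
  have "(\<lambda>\<omega>. \<Sum>y\<in>range g. y * indicator (g -` {y}) \<omega>) \<in> H"
  proof (intro H_sum H_cmult H_indicator)
    fix y show "g -` {y} \<in> sets M"
      using measurable_sets[OF assms(1), of "{y}"] by simp
  qed
  then show ?thesis
    using finite_range_decomp[OF assms(2), symmetric] by simp
qed

lemma measurable_F_mono:
  "Y \<in> borel_measurable (F s) \<Longrightarrow> s \<le> t \<Longrightarrow> Y \<in> borel_measurable (F t)"
  by (rule borel_measurable_subalgebra[of "F s"]) (simp_all add: sets_F_mono)

lemma measurable_F_M: "Y \<in> borel_measurable (F s) \<Longrightarrow> Y \<in> borel_measurable M"
  by (rule borel_measurable_subalgebra[of "F s"]) (simp_all add: sets_F_subset)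

lemma HtI: "Y \<in> H \<Longrightarrow> Y \<in> borel_measurable (F t) \<Longrightarrow> Y \<in> Ht H F t"
  unfolding Ht_def by blast

lemma Ht_H: "Y \<in> Ht H F t \<Longrightarrow> Y \<in> H" and Ht_measurable: "Y \<in> Ht H F t \<Longrightarrow> Y \<in> borel_measurable (F t)"
  unfolding Ht_def by blast+

lemma Ht_cmult: "Y \<in> Ht H F t \<Longrightarrow> (\<lambda>\<omega>. c * Y \<omega>) \<in> Ht H F t"
  by (intro HtI H_cmult borel_measurable_times borel_measurable_const)
    (rule Ht_H Ht_measurable, assumption)+

lemma Ht_uminus: "Y \<in> Ht H F t \<Longrightarrow> (\<lambda>\<omega>. - Y \<omega>) \<in> Ht H F t"
  using Ht_cmult[of Y t "-1"] by simp

lemma Ht_const: "(\<lambda>_. c) \<in> Ht H F t"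
  by (intro HtI H_const borel_measurable_const)

lemma Ht_indicator: "A \<in> sets (F t) \<Longrightarrow> indicator A \<in> Ht H F t"
  by (intro HtI H_indicator borel_measurable_indicator subsetD[OF sets_F_subset[of t]])

lemma E_Ht: "Y \<in> H \<Longrightarrow> E t Y \<in> Ht H F t"
  by (rule E_Ht_all[rule_format])

lemma E_time_consistent: "s \<le> t \<Longrightarrow> Y \<in> H \<Longrightarrow> E s (E t Y) = E s Y"
  by (rule E_time_all[rule_format])

lemma e_E: "Y \<in> H \<Longrightarrow> e (E t Y) = e Y"
  unfolding expect_def using E_time_consistent[of 0 t Y] by simp

lemma E_indicator:
  "A \<in> sets (F t) \<Longrightarrow> Y \<in> H \<Longrightarrow> E t (\<lambda>\<omega>. indicator A \<omega> * Y \<omega>) = (\<lambda>\<omega>. indicator A \<omega> * E t Y \<omega>)"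
  by (rule E_indicator_all[rule_format])

lemma E_id: "Y \<in> Ht H F t \<Longrightarrow> E t Y = Y"
  by (rule E_id_all[rule_format])

lemma E_add: "Y \<in> H \<Longrightarrow> Z \<in> H \<Longrightarrow> E t (\<lambda>\<omega>. Y \<omega> + Z \<omega>) \<omega> \<le> E t Y \<omega> + E t Z \<omega>"
  by (rule E_add_all[rule_format])

lemma e_mono: "Y \<in> H \<Longrightarrow> Z \<in> H \<Longrightarrow> (\<And>\<omega>. Y \<omega> \<le> Z \<omega>) \<Longrightarrow> e Y \<le> e Z"
  unfolding expect_def using E_mono_all[THEN spec, THEN bspec, THEN bspec, THEN mp, THEN spec, of Y Z] by blast

lemma e_add: "Y \<in> H \<Longrightarrow> Z \<in> H \<Longrightarrow> e (\<lambda>\<omega>. Y \<omega> + Z \<omega>) \<le> e Y + e Z"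
  unfolding expect_def by (rule E_add)

lemma e_const [simp]: "e (\<lambda>_. c) = c"
  unfolding expect_def by (simp add: E_id Ht_const)

lemma e_cmult:
  assumes "Y \<in> H" "c \<ge> 0"
  shows "e (\<lambda>\<omega>. c * Y \<omega>) = c * e Y"
proof -
  from E_mult_all[rule_format, OF Ht_const[of c 0] assms(1) H_cmult[OF assms(1)]] assms(2)
  show ?thesis unfolding expect_def by simp
qed

lemma e_divide: "Y \<in> H \<Longrightarrow> c \<ge> 0 \<Longrightarrow> e (\<lambda>\<omega>. Y \<omega> / c) = e Y / c"
  using e_cmult[of Y "1 / c"] by simp

lemma e_continuous:
  assumes "\<And>i. Y i \<in> H" "\<And>i \<omega>. Y (Suc i) \<omega> \<le> Y i \<omega>" "\<And>\<omega>. (\<lambda>i. Y i \<omega>) \<longlonglongrightarrow> 0"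
  shows "(\<lambda>i. e (Y i)) \<longlonglongrightarrow> 0"
  unfolding expect_def by (rule E_continuous_all[THEN spec, THEN mp, THEN spec]) (simp add: assms)

lemma e_nonneg: "Y \<in> H \<Longrightarrow> (\<And>\<omega>. 0 \<le> Y \<omega>) \<Longrightarrow> 0 \<le> e Y"
  using e_mono[OF H_const[of 0], of Y] by simp

text \<open>Constants pass through exactly although \<open>e\<close> is only subadditive: the
  reverse inequality is subadditivity for the pair \<open>Y + c\<close> and
  \<open>-c\<close>.\<close>

lemma e_add_const:
  assumes "Y \<in> H" shows "e (\<lambda>\<omega>. Y \<omega> + c) = e Y + c"
proof (rule antisym)
  show "e (\<lambda>\<omega>. Y \<omega> + c) \<le> e Y + c" using e_add[OF assms H_const[of c]] by simp
  show "e Y + c \<le> e (\<lambda>\<omega>. Y \<omega> + c)"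
    using e_add[OF H_add[OF assms H_const[of c]] H_const[of "- c"]] by simp
qed

lemma e_sum:
  "finite I \<Longrightarrow> (\<And>i. i \<in> I \<Longrightarrow> Y i \<in> H) \<Longrightarrow> e (\<lambda>\<omega>. \<Sum>i\<in>I. Y i \<omega>) \<le> (\<Sum>i\<in>I. e (Y i))"
proof (induction I rule: finite_induct)
  case (insert x I)
  have "e (\<lambda>\<omega>. Y x \<omega> + (\<Sum>i\<in>I. Y i \<omega>)) \<le> e (Y x) + e (\<lambda>\<omega>. \<Sum>i\<in>I. Y i \<omega>)"
    using insert by (intro e_add H_sum) auto
  with insert show ?case by simp
qed simp

section \<open>Capacities: subadditivity and continuity along decreasing sets\<close>

lemma V_nonneg: "A \<in> sets M \<Longrightarrow> 0 \<le> V A"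
  unfolding capacity_def by (intro e_nonneg H_indicator) auto

lemma V_mono: "A \<in> sets M \<Longrightarrow> B \<in> sets M \<Longrightarrow> A \<subseteq> B \<Longrightarrow> V A \<le> V B"
  unfolding capacity_def by (intro e_mono H_indicator) (auto simp: indicator_def)

lemma V_UNIV: "V UNIV = 1"
  unfolding capacity_def using e_const[of 1] by (simp add: indicator_def[abs_def])

lemma V_empty: "V {} = 0"
  unfolding capacity_def using e_const[of 0] by (simp add: indicator_def[abs_def])

lemma V_Un:
  assumes "A \<in> sets M" "B \<in> sets M" shows "V (A \<union> B) \<le> V A + V B"
proof -
  have "V (A \<union> B) \<le> e (\<lambda>\<omega>. indicator A \<omega> + indicator B \<omega>)"
    unfolding capacity_def using assms
    by (intro e_mono H_indicator H_add) (auto simp: indicator_def)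
  also have "\<dots> \<le> V A + V B"
    unfolding capacity_def using assms by (intro e_add H_indicator)
  finally show ?thesis .
qed

lemma V_finite_UN:
  "finite I \<Longrightarrow> (\<And>i. i \<in> I \<Longrightarrow> A i \<in> sets M) \<Longrightarrow> V (\<Union>i\<in>I. A i) \<le> (\<Sum>i\<in>I. V (A i))"
proof (induction I rule: finite_induct)
  case (insert x I)
  have "V (A x \<union> (\<Union>i\<in>I. A i)) \<le> V (A x) + V (\<Union>i\<in>I. A i)"
    using insert by (intro V_Un sets.finite_UN) auto
  with insert show ?case by simp
qed (simp add: V_empty)

lemma V_decreasing:
  assumes "\<And>n. A n \<in> sets M" "\<And>n. A (Suc n) \<subseteq> A n" "(\<Inter>n. A n) = {}"
  shows "(\<lambda>n. V (A n)) \<longlonglongrightarrow> 0"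
  unfolding capacity_def
proof (rule e_continuous)
  fix \<omega>
  from assms(3) obtain n where n: "\<omega> \<notin> A n" by auto
  have "\<omega> \<notin> A m" if "m \<ge> n" for m
    using lift_Suc_antimono_le[of A, OF assms(2) that] n by auto
  then have "\<forall>\<^sub>F m in sequentially. (indicator (A m) \<omega> :: real) = 0"
    by (auto simp: eventually_sequentially indicator_def)
  then show "(\<lambda>i. indicator (A i) \<omega> :: real) \<longlonglongrightarrow> 0"
    by (rule tendsto_eventually)
next
  fix i \<omega> show "(indicator (A (Suc i)) \<omega> :: real) \<le> indicator (A i) \<omega>"
    using assms(2)[of i] by (auto simp: indicator_def)
qed (simp add: assms(1) H_indicator)

text \<open>What a finite union misses of the whole union decreases to the empty set, so its
  capacity vanishes by \<open>V_decreasing\<close>. Bounds on finite unions thereby pass to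
  countable ones.\<close>

lemma V_UN_le:
  assumes "\<And>n. A n \<in> sets M" "\<And>L. V (\<Union>n\<in>{..<L::nat}. A n) \<le> q"
  shows "V (\<Union>n. A n) \<le> q"
proof -
  let ?B = "\<lambda>L. (\<Union>n. A n) - (\<Union>n\<in>{..<L}. A n)"
  have meas: "(\<Union>n. A n) \<in> sets M" "(\<Union>n\<in>{..<L}. A n) \<in> sets M" "?B L \<in> sets M" for L :: nat
    using assms(1) by auto
  have "(\<lambda>L. V (?B L)) \<longlonglongrightarrow> 0"
    using meas(3) by (intro V_decreasing) auto
  then have "(\<lambda>L. q + V (?B L)) \<longlonglongrightarrow> q + 0" by (intro tendsto_intros)
  moreover have "V (\<Union>n. A n) \<le> q + V (?B L)" for L
  proof -
    have "(\<Union>n\<in>{..<L}. A n) \<union> ?B L = (\<Union>n. A n)" by auto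
    then have "V (\<Union>n. A n) \<le> V (\<Union>n\<in>{..<L}. A n) + V (?B L)"
      using V_Un[OF meas(2)[of L] meas(3)[of L]] by (simp only:)
    with assms(2)[of L] show ?thesis by simp
  qed
  ultimately show ?thesis by (intro LIMSEQ_le_const) auto
qed

lemma V_UN_null:
  assumes "\<And>n::nat. A n \<in> sets M" "\<And>n. V (A n) = 0"
  shows "V (\<Union>n. A n) = 0"
proof (rule antisym)
  show "V (\<Union>n. A n) \<le> 0"
  proof (rule V_UN_le[OF assms(1)])
    fix L show "V (\<Union>n\<in>{..<L}. A n) \<le> 0"
      using V_finite_UN[of "{..<L}" A] assms by simp
  qed
  show "0 \<le> V (\<Union>n. A n)" using assms by (intro V_nonneg) auto
qed

text \<open>Common end of the maximal inequality and of Borel-Cantelli: both supply a bound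
  \<open>q N\<close> on finite blocks starting at \<open>N\<close> that is uniform in the right end
  \<open>L\<close>.\<close>

lemma V_limsup_null:
  assumes A: "\<And>n::nat. A n \<in> sets M"
    and q: "\<And>N L. V (\<Union>n\<in>{N..<L}. A n) \<le> q N" "q \<longlonglongrightarrow> 0"
  shows "V (\<Inter>N. \<Union>n\<in>{N..}. A n) = 0"
proof (rule antisym)
  have meas: "(\<Union>n\<in>{N..}. A n) \<in> sets M" "(\<Inter>N. \<Union>n\<in>{N..}. A n) \<in> sets M" for N
    using A by auto
  have "V (\<Union>n\<in>{N..}. A n) \<le> q N" for N
  proof -
    \<comment> \<open>Empty sets before index \<open>N\<close> turn the tail union into a union over
      all naturals.\<close>
    let ?A = "\<lambda>n. if N \<le> n then A n else {}"
    have "V (\<Union>n. ?A n) \<le> q N"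
    proof (rule V_UN_le)
      fix L
      have "(\<Union>n\<in>{..<L}. ?A n) = (\<Union>n\<in>{N..<L}. A n)" by (auto split: if_splits)
      then show "V (\<Union>n\<in>{..<L}. ?A n) \<le> q N" using q(1) by simp
    qed (use A in auto)
    moreover have "(\<Union>n. ?A n) = (\<Union>n\<in>{N..}. A n)" by (auto split: if_splits)
    ultimately show ?thesis by simp
  qed
  then have "V (\<Inter>N. \<Union>n\<in>{N..}. A n) \<le> q N" for N
    using V_mono[OF meas(2) meas(1)[of N]] by (smt (verit) INT_lower iso_tuple_UNIV_I)
  then show "V (\<Inter>N. \<Union>n\<in>{N..}. A n) \<le> 0"
    using q(2) by (intro LIMSEQ_le_const) auto
  show "0 \<le> V (\<Inter>N. \<Union>n\<in>{N..}. A n)" using meas by (intro V_nonneg)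
qed

section \<open>Quasi-sure statements\<close>

lemma qs_all:
  assumes "\<And>n::nat. quasi_surely M E (P n)"
  shows "quasi_surely M E (\<lambda>\<omega>. \<forall>n. P n \<omega>)"
proof -
  from assms obtain N where N: "\<And>n. N n \<in> sets M" "\<And>n. V (N n) = 0" "\<And>n \<omega>. \<omega> \<notin> N n \<Longrightarrow> P n \<omega>"
    unfolding quasi_surely_def by metis
  show ?thesis unfolding quasi_surely_def
    using N V_UN_null[of N] by (intro bexI[of _ "\<Union>n. N n"]) auto
qed

lemma qs_mp:
  assumes "quasi_surely M E P" "\<And>\<omega>. P \<omega> \<Longrightarrow> Q \<omega>"
  shows "quasi_surely M E Q"
  using assms unfolding quasi_surely_def by blast

lemma qs_conj:
  assumes "quasi_surely M E P" "quasi_surely M E Q"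
  shows "quasi_surely M E (\<lambda>\<omega>. P \<omega> \<and> Q \<omega>)"
proof -
  have "quasi_surely M E (\<lambda>\<omega>. \<forall>n::nat. (if n = 0 then P else Q) \<omega>)"
    using assms by (intro qs_all) auto
  then show ?thesis
  proof (rule qs_mp)
    fix \<omega> assume "\<forall>n::nat. (if n = 0 then P else Q) \<omega>"
    from this[rule_format, of 0] this[rule_format, of 1] show "P \<omega> \<and> Q \<omega>" by simp
  qed
qed

text \<open>The whole space has capacity 1, so no null set exhausts it. Quasi-sure identities can
  therefore be evaluated at some common point.\<close>

lemma qs_ex:
  assumes "quasi_surely M E P"
  shows "\<exists>\<omega>. P \<omega>"
proof (rule ccontr)
  assume "\<nexists>\<omega>. P \<omega>"
  with assms obtain N where "V N = 0" and all: "\<And>\<omega>. \<omega> \<in> N" unfolding quasi_surely_def by auto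
  moreover have "N = UNIV" using all by auto
  ultimately show False using V_UNIV by simp
qed

section \<open>Truncation tails and uniform integrability\<close>

lemma tail_set: "Y \<in> H \<Longrightarrow> {\<omega>. c < \<bar>Y \<omega>\<bar>} \<in> sets M"
proof -
  assume "Y \<in> H"
  then have [measurable]: "Y \<in> borel_measurable M" by (rule H_measurable)
  have "{\<omega> \<in> space M. c < \<bar>Y \<omega>\<bar>} \<in> sets M" by measurable
  then show ?thesis by simp
qed

lemma H_tail: "Y \<in> H \<Longrightarrow> (\<lambda>\<omega>. \<bar>Y \<omega>\<bar> * indicator {\<omega>. c < \<bar>Y \<omega>\<bar>} \<omega>) \<in> H"
  by (intro H_mult_indicator H_abs tail_set)

text \<open>The tail integrands decrease in \<open>n\<close> and vanish at each point once
  \<open>n\<close> has reached the absolute value there, so continuity from above applies.\<close>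

lemma tail_tendsto:
  assumes "Y \<in> H"
  shows "(\<lambda>n. e (\<lambda>\<omega>. \<bar>Y \<omega>\<bar> * indicator {\<omega>. real n < \<bar>Y \<omega>\<bar>} \<omega>)) \<longlonglongrightarrow> 0"
proof (rule e_continuous)
  fix \<omega>
  obtain n where "\<bar>Y \<omega>\<bar> \<le> real n" using real_arch_simple by blast
  then have "\<bar>Y \<omega>\<bar> * indicator {\<omega>. real m < \<bar>Y \<omega>\<bar>} \<omega> = 0" if "m \<ge> n" for m
    using that by (auto simp: indicator_def)
  then show "(\<lambda>m. \<bar>Y \<omega>\<bar> * indicator {\<omega>. real m < \<bar>Y \<omega>\<bar>} \<omega>) \<longlonglongrightarrow> 0"
    by (intro tendsto_eventually) (auto simp: eventually_sequentially)
qed (use assms H_tail in \<open>auto simp: indicator_def\<close>)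

lemma e_abs_indicator_le:
  assumes "Y \<in> H" "A \<in> sets M" "K \<ge> 0"
  shows "e (\<lambda>\<omega>. \<bar>Y \<omega>\<bar> * indicator A \<omega>)
    \<le> K * V A + e (\<lambda>\<omega>. \<bar>Y \<omega>\<bar> * indicator {\<omega>. K < \<bar>Y \<omega>\<bar>} \<omega>)"
proof -
  have "e (\<lambda>\<omega>. \<bar>Y \<omega>\<bar> * indicator A \<omega>)
    \<le> e (\<lambda>\<omega>. K * indicator A \<omega> + \<bar>Y \<omega>\<bar> * indicator {\<omega>. K < \<bar>Y \<omega>\<bar>} \<omega>)"
    using assms by (intro e_mono H_add H_tail H_cmult H_indicator H_mult_indicator H_abs)
      (auto simp: indicator_def)
  also have "\<dots> \<le> e (\<lambda>\<omega>. K * indicator A \<omega>) + e (\<lambda>\<omega>. \<bar>Y \<omega>\<bar> * indicator {\<omega>. K < \<bar>Y \<omega>\<bar>} \<omega>)"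
    using assms by (intro e_add H_tail H_cmult H_indicator)
  also have "e (\<lambda>\<omega>. K * indicator A \<omega>) = K * V A"
    unfolding capacity_def using assms by (intro e_cmult H_indicator)
  finally show ?thesis .
qed

text \<open>The level \<open>K\<close> is chosen from the tail of the single function
  \<open>Z\<close>, which all \<open>Y i\<close> share; only then is \<open>n\<close> taken so large
  that \<open>K * V (A n)\<close> is small. Hence one threshold for \<open>n\<close> serves all
  \<open>i\<close>.\<close>

lemma uniform_abs_indicator_tendsto:
  assumes Y: "\<And>i. i \<in> I \<Longrightarrow> Y i \<in> H" and Z: "Z \<in> H"
    and tail: "\<And>i K. i \<in> I \<Longrightarrow> e (\<lambda>\<omega>. \<bar>Y i \<omega>\<bar> * indicator {\<omega>. K < \<bar>Y i \<omega>\<bar>} \<omega>)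
        = e (\<lambda>\<omega>. \<bar>Z \<omega>\<bar> * indicator {\<omega>. K < \<bar>Z \<omega>\<bar>} \<omega>)"
    and A: "\<And>n. A n \<in> sets M" "(\<lambda>n::nat. V (A n)) \<longlonglongrightarrow> 0" and d: "d > 0"
  shows "\<forall>\<^sub>F n in sequentially. \<forall>i\<in>I. e (\<lambda>\<omega>. \<bar>Y i \<omega>\<bar> * indicator (A n) \<omega>) < d"
proof -
  have "\<forall>\<^sub>F n in sequentially. e (\<lambda>\<omega>. \<bar>Z \<omega>\<bar> * indicator {\<omega>. real n < \<bar>Z \<omega>\<bar>} \<omega>) < d / 2"
    using tail_tendsto[OF Z] d by (auto dest!: order_tendstoD(2)[of _ _ _ "d / 2"])
  then obtain K :: nat where K: "e (\<lambda>\<omega>. \<bar>Z \<omega>\<bar> * indicator {\<omega>. real K < \<bar>Z \<omega>\<bar>} \<omega>) < d / 2"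
    by (auto simp: eventually_sequentially)
  have "(\<lambda>n. real K * V (A n)) \<longlonglongrightarrow> real K * 0" by (intro tendsto_intros A)
  then have "\<forall>\<^sub>F n in sequentially. real K * V (A n) < d / 2"
    using d by (auto dest!: order_tendstoD(2)[of _ _ _ "d / 2"])
  then show ?thesis
  proof eventually_elim
    case (elim n)
    show ?case
    proof
      fix i assume i: "i \<in> I"
      show "e (\<lambda>\<omega>. \<bar>Y i \<omega>\<bar> * indicator (A n) \<omega>) < d"
        using e_abs_indicator_le[OF Y[OF i] A(1)[of n], of "real K"] tail[OF i, of "real K"] K elim
        by simp
    qed
  qed
qed

lemma e_abs_indicator_null:
  assumes "Y \<in> H" "N \<in> sets M" "V N = 0"
  shows "e (\<lambda>\<omega>. \<bar>Y \<omega>\<bar> * indicator N \<omega>) = 0"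
proof -
  \<comment> \<open>A one-point index set and the constant sequence \<open>N\<close> reduce the
    claim to the uniform statement.\<close>
  have "e (\<lambda>\<omega>. \<bar>Y \<omega>\<bar> * indicator N \<omega>) < d" if "d > 0" for d
    using uniform_abs_indicator_tendsto[of "{()}" "\<lambda>_. Y" Y "\<lambda>_. N" d] assms that
    by (auto simp: eventually_sequentially)
  moreover have "0 \<le> e (\<lambda>\<omega>. \<bar>Y \<omega>\<bar> * indicator N \<omega>)"
    using assms by (intro e_nonneg H_mult_indicator H_abs) auto
  ultimately show ?thesis by (meson less_irrefl not_le order_antisym)
qed

text \<open>On the exceptional null set \<open>Z\<close> is raised by |Y - Z|; the inequality then
  holds everywhere, and the correction has expectation 0.\<close>

lemma e_mono_qs:
  assumes "Y \<in> H" "Z \<in> H" "quasi_surely M E (\<lambda>\<omega>. Y \<omega> \<le> Z \<omega>)"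
  shows "e Y \<le> e Z"
proof -
  from assms(3) obtain N where N: "N \<in> sets M" "V N = 0" "\<And>\<omega>. \<omega> \<notin> N \<Longrightarrow> Y \<omega> \<le> Z \<omega>"
    unfolding quasi_surely_def by auto
  have D: "(\<lambda>\<omega>. Y \<omega> - Z \<omega>) \<in> H" using assms by (intro H_diff)
  have "e Y \<le> e (\<lambda>\<omega>. Z \<omega> + \<bar>Y \<omega> - Z \<omega>\<bar> * indicator N \<omega>)"
    using assms(1,2) D N by (intro e_mono H_add H_mult_indicator H_abs) (auto simp: indicator_def)
  also have "\<dots> \<le> e Z + e (\<lambda>\<omega>. \<bar>Y \<omega> - Z \<omega>\<bar> * indicator N \<omega>)"
    using assms(1,2) D N by (intro e_add H_mult_indicator H_abs)
  finally show ?thesis using e_abs_indicator_null[OF D N(1,2)] by simp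
qed

end

section \<open>Maximal inequality and one-sided strong law\<close>

text \<open>One-sided substitute for expanding a square: the mixed term carries the nonnegative
  factor \<open>2 * max u 0\<close>, so when \<open>u\<close> comes from the past and
  \<open>w\<close> is an independent increment, its expectation is nonpositive as soon as that of
  \<open>w\<close> is.\<close>

lemma pos_part_sum_square_le:
  fixes u w :: real
  shows "(max (u + w) 0)\<^sup>2 \<le> (max u 0)\<^sup>2 + 2 * max u 0 * w + w\<^sup>2"
proof (cases "u + w \<le> 0")
  case True
  then have "(max u 0)\<^sup>2 + 2 * max u 0 * w + w\<^sup>2 = (max u 0 + w)\<^sup>2"
    by (simp add: power2_sum)
  with True show ?thesis by (simp add: max_def)
next
  case False
  show ?thesis
  proof (cases "u \<ge> 0")
    case True
    with False show ?thesis by (simp add: power2_sum max_def)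
  next
    assume "\<not> u \<ge> 0"
    moreover from this False have "(u + w)\<^sup>2 \<le> w\<^sup>2" by (intro power_mono) auto
    ultimately show ?thesis using False by (simp add: max_def)
  qed
qed

text \<open>\<open>q N\<close> is the whole series with the index in the denominator raised to at
  least \<open>N\<close>. Each term tends to 0 in \<open>N\<close> and is dominated by the given
  summable series, so Tannery's theorem applies.\<close>

lemma summable_kronecker:
  fixes v :: "nat \<Rightarrow> real"
  assumes v: "\<And>i. 0 \<le> v i" and s: "summable (\<lambda>i. v (Suc i) / (real (Suc i))\<^sup>2)"
  obtains q where "\<And>N L. (\<Sum>i<L. v (Suc i) / (real (max (Suc i) N))\<^sup>2) \<le> q N" "q \<longlonglongrightarrow> 0"
proof -
  define a where "a i N = v (Suc i) / (real (max (Suc i) N))\<^sup>2" for i N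
  have a0: "0 \<le> a i N" for i N unfolding a_def using v by simp
  have a_le: "a i N \<le> v (Suc i) / (real (Suc i))\<^sup>2" for i N
    unfolding a_def using v by (intro divide_left_mono power_mono mult_pos_pos) auto
  have lim: "(\<lambda>N. a i N) \<longlonglongrightarrow> 0" for i
  proof -
    have "(\<lambda>N. v (Suc i) / (real N)\<^sup>2) \<longlonglongrightarrow> 0"
      by (intro real_tendsto_divide_at_top[OF tendsto_const] filterlim_pow_at_top filterlim_real_sequentially) simp
    moreover have "\<forall>\<^sub>F N in sequentially. v (Suc i) / (real N)\<^sup>2 = a i N"
      unfolding a_def eventually_sequentially by (intro exI[of _ "Suc i"]) (auto simp: max_def)
    ultimately show ?thesis by (rule Lim_transform_eventually)
  qed
  have summ: "summable (\<lambda>i. a i N)" for N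
    using s a0 a_le by (intro summable_comparison_test'[OF s]) auto
  have "(\<lambda>N. \<Sum>i. a i N) \<longlonglongrightarrow> suminf (\<lambda>i. 0)"
  proof (rule tannerys_theorem[THEN conjunct2, THEN conjunct2, OF lim _ s])
    have "norm (a i N) \<le> v (Suc i) / (real (Suc i))\<^sup>2" for i N using a0 a_le by simp
    then show "\<forall>\<^sub>F (i, N) in sequentially \<times>\<^sub>F sequentially.
        norm (a i N) \<le> v (Suc i) / (real (Suc i))\<^sup>2"
      by (intro always_eventually) auto
  qed simp
  moreover have "(\<Sum>i<L. a i N) \<le> (\<Sum>i. a i N)" for N L
    using a0 by (intro sum_le_suminf summ) auto
  ultimately show ?thesis using that[of "\<lambda>N. \<Sum>i. a i N"] unfolding a_def by simp
qed

section \<open>Independence against weights from the past, and the law for simple increments\<close>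

context SL_space
begin

text \<open>Independence from \<open>F n\<close> is given through test functions on the plane paired
  with indicators. For the test function \<open>z * f y\<close> the value \<open>z\<close> of the
  indicator is nonnegative and leaves the inner expectation by positive homogeneity.\<close>

lemma indep_indicator:
  assumes ind: "indep_of_Ft H F E Y n" and A: "A \<in> sets (F n)"
    and f[measurable]: "f \<in> borel_measurable borel" and fY: "(\<lambda>\<omega>. f (Y \<omega>)) \<in> H"
  shows "e (\<lambda>\<omega>. indicator A \<omega> * f (Y \<omega>)) = e (\<lambda>\<omega>. indicator A \<omega> * e (\<lambda>\<omega>. f (Y \<omega>)))"
proof -
  define \<phi> :: "real \<times> real \<Rightarrow> real" where "\<phi> = (\<lambda>(z, y). z * f y)"
  have "\<phi> \<in> borel_measurable (borel \<Otimes>\<^sub>M borel)" unfolding \<phi>_def by measurable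
  then have "\<phi> \<in> borel_measurable borel" by (simp add: borel_prod)
  moreover have "(\<lambda>\<omega>. \<phi> (indicator A \<omega>, Y \<omega>)) \<in> H"
    unfolding \<phi>_def using H_indicator_mult[OF fY] A sets_F_subset[of n] by auto
  moreover have "\<forall>z. (\<lambda>\<omega>. \<phi> (z, Y \<omega>)) \<in> H"
    unfolding \<phi>_def using H_cmult[OF fY] by simp
  ultimately have "e (\<lambda>\<omega>. \<phi> (indicator A \<omega>, Y \<omega>)) = e (\<lambda>\<omega>. e (\<lambda>\<omega>'. \<phi> (indicator A \<omega>, Y \<omega>')))"
    using ind A unfolding indep_of_Ft_def indep_of_def by blast
  moreover have "e (\<lambda>\<omega>'. \<phi> (indicator A \<omega>, Y \<omega>')) = indicator A \<omega> * e (\<lambda>\<omega>. f (Y \<omega>))" for \<omega>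
    unfolding \<phi>_def using e_cmult[OF fY, of "indicator A \<omega>"] by simp
  ultimately show ?thesis unfolding \<phi>_def by simp
qed

text \<open>Replaces conditioning on \<open>F n\<close>: the level sets of \<open>a\<close> belong
  to \<open>F n\<close>, on each of them independence exchanges \<open>f Y\<close> for its
  nonpositive expectation, and the level values are nonnegative, so subadditivity adds up the
  pieces.\<close>

lemma e_finite_range_mult_nonpos:
  assumes ind: "indep_of_Ft H F E Y n"
    and f: "f \<in> borel_measurable borel" and fY: "(\<lambda>\<omega>. f (Y \<omega>)) \<in> H"
    and le: "e (\<lambda>\<omega>. f (Y \<omega>)) \<le> 0"
    and a: "a \<in> borel_measurable (F n)" "finite (range a)" "\<And>\<omega>. 0 \<le> a \<omega>"
  shows "e (\<lambda>\<omega>. a \<omega> * f (Y \<omega>)) \<le> 0"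
proof -
  have A: "a -` {y} \<in> sets (F n)" for y using measurable_sets[OF a(1), of "{y}"] by simp
  then have AM: "a -` {y} \<in> sets M" for y using sets_F_subset by blast
  let ?g = "\<lambda>y \<omega>. indicator (a -` {y}) \<omega> * f (Y \<omega>)"
  have gH: "?g y \<in> H" for y by (intro H_indicator_mult fY AM)
  have g: "e (?g y) \<le> 0" for y
    unfolding indep_indicator[OF ind A f fY]
    using e_mono[of "\<lambda>\<omega>. indicator (a -` {y}) \<omega> * e (\<lambda>\<omega>. f (Y \<omega>))" "\<lambda>_. 0"] le
      H_indicator_mult[OF H_const AM] H_const
    by (simp add: mult_nonneg_nonpos)
  have "a \<omega> * f (Y \<omega>) = (\<Sum>y\<in>range a. y * ?g y \<omega>)" for \<omega>
  proof -
    have "a \<omega> * f (Y \<omega>) = (\<Sum>y\<in>range a. y * indicator (a -` {y}) \<omega>) * f (Y \<omega>)"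
      using fun_cong[OF finite_range_decomp[OF a(2)], of \<omega>] by (rule arg_cong)
    then show ?thesis by (simp add: sum_distrib_right mult.assoc)
  qed
  then have "e (\<lambda>\<omega>. a \<omega> * f (Y \<omega>)) = e (\<lambda>\<omega>. \<Sum>y\<in>range a. y * ?g y \<omega>)" by simp
  also have "\<dots> \<le> (\<Sum>y\<in>range a. e (\<lambda>\<omega>. y * ?g y \<omega>))"
    using a(2) by (intro e_sum H_cmult gH)
  also have "\<dots> \<le> 0"
  proof (rule sum_nonpos)
    fix y assume "y \<in> range a"
    then have y: "0 \<le> y" using a(3) by auto
    then show "e (\<lambda>\<omega>. y * ?g y \<omega>) \<le> 0"
      using e_cmult[OF gH[of y] y] g[of y] by (simp add: mult_nonneg_nonpos)
  qed
  finally show ?thesis .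
qed

text \<open>Hajek-Renyi argument: the weighted square of \<open>(U n)\<^sup>+\<close> is frozen at the value \<open>\<epsilon>\<^sup>2\<close> once
  \<open>U\<close> has crossed the line of slope \<open>\<epsilon>\<close> at a time \<open>\<ge> N\<close>.\<close>
lemma maximal_inequality:
  fixes W :: "nat \<Rightarrow> 'a \<Rightarrow> real"
  assumes W: "\<And>n. W n \<in> borel_measurable (F n)" "\<And>n. finite (range (W n))"
    and neg: "\<And>n a. a \<in> borel_measurable (F n) \<Longrightarrow> finite (range a) \<Longrightarrow> (\<And>\<omega>. 0 \<le> a \<omega>) \<Longrightarrow>
      e (\<lambda>\<omega>. a \<omega> * W (Suc n) \<omega>) \<le> 0"
    and N: "N \<ge> 1" and eps: "\<epsilon> > 0"
  defines "U \<equiv> \<lambda>n \<omega>. \<Sum>i<n. W (Suc i) \<omega>"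
  shows "\<epsilon>\<^sup>2 * V (\<Union>n\<in>{N..<L}. {\<omega>. \<epsilon> * real n \<le> U n \<omega>})
    \<le> (\<Sum>i<L. e (\<lambda>\<omega>. (W (Suc i) \<omega>)\<^sup>2) / (real (max (Suc i) N))\<^sup>2)"
proof -
  define C where "C n = (\<Union>k\<in>{N..n}. {\<omega>. \<epsilon> * real k \<le> U k \<omega>})" for n
  define m where "m n = (real (max n N))\<^sup>2" for n
  define J where "J n \<omega> = \<epsilon>\<^sup>2 * indicator (C n) \<omega> + (1 - indicator (C n) \<omega>) * ((max (U n \<omega>) 0)\<^sup>2 / m n)" for n \<omega>
  define a where "a n \<omega> = (1 - indicator (C n) \<omega>) * (2 * max (U n \<omega>) 0 / m (Suc n))" for n \<omega>
  have m_pos: "m n > 0" for n using N unfolding m_def by simp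
  have U_meas: "U n \<in> borel_measurable (F n)" for n
    unfolding U_def
  proof (intro borel_measurable_sum)
    fix i assume "i \<in> {..<n}" then show "W (Suc i) \<in> borel_measurable (F n)"
      by (intro measurable_F_mono[OF W(1)]) auto
  qed
  have U_fin: "finite (range (U n))" for n
  proof (induction n)
    case (Suc n)
    from finite_range_comp2[OF Suc W(2), of "(+)" "Suc n"] show ?case by (simp add: U_def)
  qed (simp add: U_def)
  have C_F: "C n \<in> sets (F n)" for n
    unfolding C_def
  proof (intro sets.finite_UN)
    fix k assume k: "k \<in> {N..n}"
    have [measurable]: "U k \<in> borel_measurable (F n)" using k by (intro measurable_F_mono[OF U_meas]) simp
    have "{\<omega> \<in> space (F n). \<epsilon> * real k \<le> U k \<omega>} \<in> sets (F n)" by measurable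
    then show "{\<omega>. \<epsilon> * real k \<le> U k \<omega>} \<in> sets (F n)" by simp
  qed simp
  have C_mono: "C n \<subseteq> C (Suc n)" for n unfolding C_def by (intro UN_mono) auto
  have ind_fin: "finite (range (indicator A :: 'a \<Rightarrow> real))" for A
    by (rule finite_subset[of _ "{0, 1}"]) (auto simp: indicator_def)
  have J_H: "J n \<in> H" for n
  proof (rule H_finite_range)
    show "J n \<in> borel_measurable M"
      unfolding J_def[abs_def] using C_F[of n] measurable_F_M[OF U_meas[of n]] sets_F_subset[of n]
      by (intro borel_measurable_add borel_measurable_times borel_measurable_const
          borel_measurable_diff borel_measurable_indicator borel_measurable_divide
          borel_measurable_power borel_measurable_max) auto
    have "finite (range (\<lambda>\<omega>. (\<lambda>i u. \<epsilon>\<^sup>2 * i + (1 - i) * ((max u 0)\<^sup>2 / m n)) (indicator (C n) \<omega>) (U n \<omega>)))"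
      by (rule finite_range_comp2[OF ind_fin U_fin])
    then show "finite (range (J n))" unfolding J_def by simp
  qed
  have a_meas: "a n \<in> borel_measurable (F n)" for n
    unfolding a_def[abs_def] using C_F[of n] U_meas[of n]
    by (intro borel_measurable_times borel_measurable_const
        borel_measurable_diff borel_measurable_indicator borel_measurable_divide
        borel_measurable_max) auto
  have a_fin: "finite (range (a n))" for n
  proof -
    have "finite (range (\<lambda>\<omega>. (\<lambda>i u. (1 - i) * (2 * max u 0 / m (Suc n))) (indicator (C n) \<omega>) (U n \<omega>)))"
      by (rule finite_range_comp2[OF ind_fin U_fin])
    then show ?thesis unfolding a_def by simp
  qed
  have a_nonneg: "0 \<le> a n \<omega>" for n \<omega>
    unfolding a_def using m_pos[of "Suc n"] by (auto simp: indicator_def)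
  have W2_H: "(\<lambda>\<omega>. (W n \<omega>)\<^sup>2) \<in> H" for n
    by (intro H_finite_range borel_measurable_power measurable_F_M[OF W(1)] finite_range_comp[OF W(2)])
  have aW_H: "(\<lambda>\<omega>. a n \<omega> * W (Suc n) \<omega>) \<in> H" for n
    by (intro H_finite_range borel_measurable_times measurable_F_M[OF W(1)] measurable_F_M[OF a_meas]
        finite_range_comp2[OF a_fin W(2)])
  \<comment> \<open>After a crossing \<open>J\<close> is constant and the right side only gains a
    nonnegative term. Otherwise the square is expanded, and dividing its old part by
    \<open>m (Suc n)\<close> instead of the smaller \<open>m n\<close> only lowers it.\<close>
  have step: "J (Suc n) \<omega> \<le> J n \<omega> + (a n \<omega> * W (Suc n) \<omega> + (W (Suc n) \<omega>)\<^sup>2 / m (Suc n))" for n \<omega>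
  proof (cases "\<omega> \<in> C n")
    case True
    then have "\<omega> \<in> C (Suc n)" using C_mono by auto
    with True show ?thesis unfolding J_def a_def using m_pos[of "Suc n"] by simp
  next
    case False
    let ?u = "U n \<omega>" and ?w = "W (Suc n) \<omega>"
    have U_Suc: "U (Suc n) \<omega> = ?u + ?w" by (simp add: U_def)
    have mm: "m n \<le> m (Suc n)" unfolding m_def by (intro power_mono) auto
    have "J (Suc n) \<omega> \<le> (max (U (Suc n) \<omega>) 0)\<^sup>2 / m (Suc n)"
    proof (cases "\<omega> \<in> C (Suc n)")
      case True
      then obtain k where k: "k \<in> {N..Suc n}" "\<epsilon> * real k \<le> U k \<omega>" unfolding C_def by auto
      have "k = Suc n"
      proof (rule ccontr)
        assume "k \<noteq> Suc n"
        with k have "\<omega> \<in> C n" unfolding C_def by auto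
        with False show False by simp
      qed
      with k have "N \<le> Suc n" and ge: "\<epsilon> * real (Suc n) \<le> U (Suc n) \<omega>" by auto
      then have "m (Suc n) = (real (Suc n))\<^sup>2" unfolding m_def by (simp add: max_def)
      then have "\<epsilon>\<^sup>2 * m (Suc n) = (\<epsilon> * real (Suc n))\<^sup>2" by (simp only: power_mult_distrib)
      also have "\<dots> \<le> (max (U (Suc n) \<omega>) 0)\<^sup>2"
        using ge eps by (intro power_mono) auto
      finally have "\<epsilon>\<^sup>2 \<le> (max (U (Suc n) \<omega>) 0)\<^sup>2 / m (Suc n)"
        using m_pos[of "Suc n"] by (simp add: pos_le_divide_eq)
      with True show ?thesis unfolding J_def by simp
    next
      case False
      then show ?thesis unfolding J_def by simp
    qed
    also have "\<dots> \<le> ((max ?u 0)\<^sup>2 + 2 * max ?u 0 * ?w + ?w\<^sup>2) / m (Suc n)"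
      unfolding U_Suc using pos_part_sum_square_le m_pos[of "Suc n"] by (intro divide_right_mono) auto
    also have "\<dots> = (max ?u 0)\<^sup>2 / m (Suc n) + (a n \<omega> * ?w + ?w\<^sup>2 / m (Suc n))"
      using False unfolding a_def by (simp add: add_divide_distrib)
    also have "(max ?u 0)\<^sup>2 / m (Suc n) \<le> (max ?u 0)\<^sup>2 / m n"
      using mm m_pos[of n] by (intro divide_left_mono mult_pos_pos m_pos) auto
    also have "\<dots> = J n \<omega>" using False unfolding J_def by simp
    finally show ?thesis by simp
  qed
  have "e (J n) \<le> (\<Sum>i<n. e (\<lambda>\<omega>. (W (Suc i) \<omega>)\<^sup>2) / m (Suc i))" for n
  proof (induction n)
    case 0
    \<comment> \<open>\<open>N \<ge> 1\<close> keeps time 0 out, where both sides of the crossing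
      condition are 0.\<close>
    have "C 0 = {}" using N unfolding C_def by auto
    then have "J 0 = (\<lambda>_. 0)" unfolding J_def by (simp add: U_def)
    then show ?case by simp
  next
    case (Suc n)
    let ?R = "\<lambda>\<omega>. a n \<omega> * W (Suc n) \<omega> + (W (Suc n) \<omega>)\<^sup>2 / m (Suc n)"
    have R_H: "?R \<in> H" by (intro H_add aW_H H_divide W2_H)
    have "e (J (Suc n)) \<le> e (\<lambda>\<omega>. J n \<omega> + ?R \<omega>)"
      by (intro e_mono J_H H_add R_H step)
    also have "\<dots> \<le> e (J n) + e ?R" by (intro e_add J_H R_H)
    also have "e ?R \<le> e (\<lambda>\<omega>. a n \<omega> * W (Suc n) \<omega>) + e (\<lambda>\<omega>. (W (Suc n) \<omega>)\<^sup>2 / m (Suc n))"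
      by (intro e_add aW_H H_divide W2_H)
    \<comment> \<open>\<open>a n\<close> is nonnegative, simple and \<open>F n\<close>-measurable,
      so the drift hypothesis removes the mixed term.\<close>
    also have "e (\<lambda>\<omega>. a n \<omega> * W (Suc n) \<omega>) \<le> 0" by (intro neg a_meas a_fin a_nonneg)
    also have "e (\<lambda>\<omega>. (W (Suc n) \<omega>)\<^sup>2 / m (Suc n)) = e (\<lambda>\<omega>. (W (Suc n) \<omega>)\<^sup>2) / m (Suc n)"
      using m_pos[of "Suc n"] by (intro e_divide W2_H) simp
    finally show ?case using Suc by simp
  qed
  note J_le = this[of L]
  have CM: "C L \<in> sets M" using C_F sets_F_subset by blast
  have "\<epsilon>\<^sup>2 * V (\<Union>n\<in>{N..<L}. {\<omega>. \<epsilon> * real n \<le> U n \<omega>}) \<le> \<epsilon>\<^sup>2 * V (C L)"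
  proof (intro mult_left_mono V_mono CM sets.finite_UN)
    fix k
    have [measurable]: "U k \<in> borel_measurable M" by (rule measurable_F_M[OF U_meas])
    have "{\<omega> \<in> space M. \<epsilon> * real k \<le> U k \<omega>} \<in> sets M" by measurable
    then show "{\<omega>. \<epsilon> * real k \<le> U k \<omega>} \<in> sets M" by simp
  next
    show "(\<Union>n\<in>{N..<L}. {\<omega>. \<epsilon> * real n \<le> U n \<omega>}) \<subseteq> C L"
      unfolding C_def by (intro UN_mono) auto
  qed simp_all
  also have "\<dots> = e (\<lambda>\<omega>. \<epsilon>\<^sup>2 * indicator (C L) \<omega>)"
    unfolding capacity_def by (rule e_cmult[symmetric]) (auto intro: H_indicator CM)
  also have "\<dots> \<le> e (J L)"
  proof (intro e_mono J_H H_cmult H_indicator CM)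
    fix \<omega> show "\<epsilon>\<^sup>2 * indicator (C L) \<omega> \<le> J L \<omega>"
      unfolding J_def using m_pos[of L] by (auto simp: indicator_def)
  qed
  also note J_le
  finally show ?thesis unfolding m_def .
qed

text \<open>The maximal inequality bounds the capacity of a crossing after time \<open>N\<close>
  uniformly in the horizon \<open>L\<close>, and \<open>summable_kronecker\<close> lets this bound
  vanish as \<open>N\<close> grows; so infinitely many crossings form a null event.\<close>

lemma upper_strong_law:
  fixes W :: "nat \<Rightarrow> 'a \<Rightarrow> real"
  assumes W: "\<And>n. W n \<in> borel_measurable (F n)" "\<And>n. finite (range (W n))"
    and neg: "\<And>n a. a \<in> borel_measurable (F n) \<Longrightarrow> finite (range a) \<Longrightarrow> (\<And>\<omega>. 0 \<le> a \<omega>) \<Longrightarrow>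
      e (\<lambda>\<omega>. a \<omega> * W (Suc n) \<omega>) \<le> 0"
    and summ: "summable (\<lambda>i. e (\<lambda>\<omega>. (W (Suc i) \<omega>)\<^sup>2) / (real (Suc i))\<^sup>2)"
    and eps: "\<epsilon> > 0"
  shows "quasi_surely M E (\<lambda>\<omega>. \<forall>\<^sub>F n in sequentially. (\<Sum>i<n. W (Suc i) \<omega>) < \<epsilon> * real n)"
proof -
  have W2_H: "(\<lambda>\<omega>. (W n \<omega>)\<^sup>2) \<in> H" for n
    by (intro H_finite_range borel_measurable_power measurable_F_M[OF W(1)] finite_range_comp[OF W(2)])
  have W2_nonneg: "0 \<le> e (\<lambda>\<omega>. (W n \<omega>)\<^sup>2)" for n by (intro e_nonneg W2_H) simp
  obtain q where q: "\<And>N L. (\<Sum>i<L. e (\<lambda>\<omega>. (W (Suc i) \<omega>)\<^sup>2) / (real (max (Suc i) N))\<^sup>2) \<le> q N" "q \<longlonglongrightarrow> 0"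
    using summable_kronecker[of "\<lambda>i. e (\<lambda>\<omega>. (W i \<omega>)\<^sup>2)", OF W2_nonneg summ] by blast
  \<comment> \<open>Time 0 is excluded because the inequality there reads \<open>0 \<le> 0\<close>;
    accordingly the blocks below start at \<open>max N 1\<close>.\<close>
  define A where "A n = {\<omega>. n \<ge> 1 \<and> \<epsilon> * real n \<le> (\<Sum>i<n. W (Suc i) \<omega>)}" for n
  have A: "A n \<in> sets M" for n
  proof -
    note [measurable] = measurable_F_M[OF W(1)]
    have "{\<omega> \<in> space M. n \<ge> 1 \<and> \<epsilon> * real n \<le> (\<Sum>i<n. W (Suc i) \<omega>)} \<in> sets M" by measurable
    then show ?thesis unfolding A_def by simp
  qed
  have "V (\<Inter>N. \<Union>n\<in>{N..}. A n) = 0"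
  proof (rule V_limsup_null[OF A])
    fix N L
    have "(\<Union>n\<in>{N..<L}. A n) = (\<Union>n\<in>{max N 1..<L}. {\<omega>. \<epsilon> * real n \<le> (\<Sum>i<n. W (Suc i) \<omega>)})"
      unfolding A_def by auto
    moreover have "\<epsilon>\<^sup>2 * V (\<Union>n\<in>{max N 1..<L}. {\<omega>. \<epsilon> * real n \<le> (\<Sum>i<n. W (Suc i) \<omega>)})
      \<le> (\<Sum>i<L. e (\<lambda>\<omega>. (W (Suc i) \<omega>)\<^sup>2) / (real (max (Suc i) (max N 1)))\<^sup>2)"
      by (rule maximal_inequality[OF W _ _ eps]) (use neg in auto)
    moreover note q(1)[where L = L and N = "max N 1"]
    ultimately have "\<epsilon>\<^sup>2 * V (\<Union>n\<in>{N..<L}. A n) \<le> q (max N 1)" by (simp only:)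
    then show "V (\<Union>n\<in>{N..<L}. A n) \<le> q (max N 1) / \<epsilon>\<^sup>2"
      using eps by (simp add: field_simps)
  next
    have "(\<lambda>N. q (max N 1)) \<longlonglongrightarrow> 0"
      by (rule Lim_transform_eventually[OF q(2)])
        (auto simp: eventually_sequentially max_def intro!: exI[of _ 1])
    then show "(\<lambda>N. q (max N 1) / \<epsilon>\<^sup>2) \<longlonglongrightarrow> 0" using tendsto_divide_zero by blast
  qed
  moreover have "\<forall>\<^sub>F n in sequentially. (\<Sum>i<n. W (Suc i) \<omega>) < \<epsilon> * real n"
    if "\<omega> \<notin> (\<Inter>N. \<Union>n\<in>{N..}. A n)" for \<omega>
  proof -
    from that obtain N where "\<And>n. n \<ge> N \<Longrightarrow> \<omega> \<notin> A n" by auto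
    then show ?thesis
      unfolding eventually_sequentially A_def by (intro exI[of _ "max N 1"]) (auto simp: not_le)
  qed
  moreover have "(\<Inter>N. \<Union>n\<in>{N..}. A n) \<in> sets M" using A by auto
  ultimately show ?thesis unfolding quasi_surely_def by blast
qed

lemma borel_cantelli:
  assumes A: "\<And>n. A n \<in> sets M" and s: "summable (\<lambda>n. V (A n))"
  shows "quasi_surely M E (\<lambda>\<omega>. \<forall>\<^sub>F n in sequentially. \<omega> \<notin> A n)"
proof -
  have "V (\<Inter>N. \<Union>n\<in>{N..}. A n) = 0"
  proof (rule V_limsup_null[OF A])
    fix N L
    have "V (\<Union>n\<in>{N..<L}. A n) \<le> (\<Sum>n\<in>{N..<L}. V (A n))" by (intro V_finite_UN A) auto
    also have "\<dots> = (\<Sum>n\<in>{..<L - N}. V (A (n + N)))"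
      by (rule sum.reindex_bij_witness[of _ "\<lambda>n. n + N" "\<lambda>n. n - N"]) auto
    also have "\<dots> \<le> (\<Sum>n. V (A (n + N)))"
      using V_nonneg[OF A] by (intro sum_le_suminf summable_ignore_initial_segment[OF s]) auto
    finally show "V (\<Union>n\<in>{N..<L}. A n) \<le> (\<Sum>n. V (A (n + N)))" .
  qed (rule suminf_exist_split2[OF s])
  moreover have "\<forall>\<^sub>F n in sequentially. \<omega> \<notin> A n" if "\<omega> \<notin> (\<Inter>N. \<Union>n\<in>{N..}. A n)" for \<omega>
    using that unfolding eventually_sequentially by auto
  moreover have "(\<Inter>N. \<Union>n\<in>{N..}. A n) \<in> sets M" using A by auto
  ultimately show ?thesis unfolding quasi_surely_def by blast
qed

end

section \<open>Independent identically distributed sequences\<close>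

text \<open>After exchanging the order of summation, \<open>p m\<close> carries the factor
  \<open>m + 1\<close> times a tail of the inverse squares, which is of order
  \<open>1 / (m + 1)\<close>. The proof does this by telescoping.\<close>

lemma summable_weighted_partial_sums:
  fixes p :: "nat \<Rightarrow> real"
  assumes p: "\<And>m. 0 \<le> p m" "summable p"
  shows "summable (\<lambda>j. (\<Sum>m<Suc j. real (Suc m) * p m) / (real (Suc j))\<^sup>2)"
proof (rule summableI_nonneg_bounded)
  define T where "T n = (\<Sum>m<n. real (Suc m) * p m)" for n
  have T0: "0 \<le> T n" for n unfolding T_def by (intro sum_nonneg) (use p in auto)
  fix n
  show "0 \<le> (\<Sum>m<Suc n. real (Suc m) * p m) / (real (Suc n))\<^sup>2"
    using T0[of "Suc n"] unfolding T_def by simp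
  \<comment> \<open>The subtracted term closes the induction through
    \<open>1 / k^2 \<le> 2 * (1 / k - 1 / (k + 1))\<close> for \<open>k = n + 1\<close>; it is
    dropped afterwards.\<close>
  have "(\<Sum>j<n. T (Suc j) / (real (Suc j))\<^sup>2) \<le> 2 * (\<Sum>m<n. p m) - 2 * T n / real (Suc n)"
  proof (induction n)
    case 0
    then show ?case by (simp add: T_def)
  next
    case (Suc n)
    have T_Suc: "T (Suc n) = T n + real (Suc n) * p n" unfolding T_def by simp
    have "1 / (real (Suc n))\<^sup>2 \<le> 2 * (1 / real (Suc n) - 1 / real (Suc (Suc n)))"
      by (simp add: divide_simps power2_eq_square)
    from mult_left_mono[OF this T0[of "Suc n"]]
    have "T (Suc n) / (real (Suc n))\<^sup>2 \<le> 2 * T (Suc n) / real (Suc n) - 2 * T (Suc n) / real (Suc (Suc n))"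
      by (simp add: algebra_simps)
    also have "2 * T (Suc n) / real (Suc n) = 2 * T n / real (Suc n) + 2 * p n"
      unfolding T_Suc by (simp add: field_simps)
    finally show ?case using Suc by simp
  qed
  also have "\<dots> \<le> 2 * (\<Sum>m<n. p m)" using T0[of n] by simp
  also have "\<dots> \<le> 2 * suminf p" using p by (intro mult_left_mono sum_le_suminf) auto
  finally show "(\<Sum>j<n. (\<Sum>m<Suc j. real (Suc m) * p m) / (real (Suc j))\<^sup>2) \<le> 2 * suminf p"
    unfolding T_def .
qed

text \<open>On the slice between \<open>m\<close> and \<open>m + 1\<close> one factor |x| is at most
  \<open>m + 1\<close>. Truncated second moments are thus controlled by the first-moment slices of
  the summability hypothesis.\<close>

lemma square_le_weighted_slices:
  fixes x :: real
  shows "x\<^sup>2 * of_bool (\<bar>x\<bar> \<le> real n) \<le>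
    (\<Sum>m<n. real (Suc m) * (\<bar>x\<bar> * of_bool (real m < \<bar>x\<bar> \<and> \<bar>x\<bar> \<le> real m + 1)))"
proof (induction n)
  case (Suc n)
  show ?case
  proof (cases "\<bar>x\<bar> \<le> real n")
    case True
    with Suc show ?thesis by simp
  next
    case False
    have "0 \<le> (\<Sum>m<n. real (Suc m) * (\<bar>x\<bar> * of_bool (real m < \<bar>x\<bar> \<and> \<bar>x\<bar> \<le> real m + 1)))"
      by (intro sum_nonneg) auto
    moreover have "x\<^sup>2 \<le> real (Suc n) * \<bar>x\<bar>" if "\<bar>x\<bar> \<le> real n + 1"
      using mult_right_mono[OF that abs_ge_zero[of x]] by (simp add: power2_eq_square abs_mult_self_eq add.commute)
    ultimately show ?thesis using False by (auto simp: add.commute)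
  qed
qed simp

text \<open>Rounding goes upward because sums are to be bounded from above: on the kept range
  \<open>x\<close> is dominated, at a cost of at most \<open>\<delta>\<close>.\<close>

definition ceil_trunc :: "real \<Rightarrow> nat \<Rightarrow> real \<Rightarrow> real" where
  "ceil_trunc \<delta> n x = (if \<bar>x\<bar> \<le> real n then \<delta> * of_int \<lceil>x / \<delta>\<rceil> else 0)"

lemma ceil_trunc_measurable: "ceil_trunc \<delta> n \<in> borel_measurable borel"
  unfolding ceil_trunc_def[abs_def] by measurable

lemma ceil_trunc_finite_range:
  assumes "\<delta> > 0"
  shows "finite (range (ceil_trunc \<delta> n))"
proof (rule finite_subset)
  show "range (ceil_trunc \<delta> n) \<subseteq> insert 0 ((\<lambda>k::int. \<delta> * of_int k) ` {\<lceil>- real n / \<delta>\<rceil>..\<lceil>real n / \<delta>\<rceil>})"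
  proof
    fix y assume "y \<in> range (ceil_trunc \<delta> n)"
    then obtain x where y: "y = ceil_trunc \<delta> n x" by auto
    show "y \<in> insert 0 ((\<lambda>k::int. \<delta> * of_int k) ` {\<lceil>- real n / \<delta>\<rceil>..\<lceil>real n / \<delta>\<rceil>})"
    proof (cases "\<bar>x\<bar> \<le> real n")
      case True
      then have "- real n / \<delta> \<le> x / \<delta>" "x / \<delta> \<le> real n / \<delta>"
        using assms by (intro divide_right_mono; simp)+
      then have "\<lceil>x / \<delta>\<rceil> \<in> {\<lceil>- real n / \<delta>\<rceil>..\<lceil>real n / \<delta>\<rceil>}"
        by (simp only: atLeastAtMost_iff ceiling_mono)
      with True y show ?thesis unfolding ceil_trunc_def by auto
    qed (simp add: y ceil_trunc_def)
  qed
qed simp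

lemma ceil_bounds:
  assumes "(\<delta>::real) > 0"
  shows "x \<le> \<delta> * of_int \<lceil>x / \<delta>\<rceil>" "\<delta> * of_int \<lceil>x / \<delta>\<rceil> \<le> x + \<delta>"
proof -
  have "x / \<delta> \<le> of_int \<lceil>x / \<delta>\<rceil>" "of_int \<lceil>x / \<delta>\<rceil> \<le> x / \<delta> + 1" by linarith+
  from this[THEN mult_left_mono, of \<delta>] assms
  show "x \<le> \<delta> * of_int \<lceil>x / \<delta>\<rceil>" "\<delta> * of_int \<lceil>x / \<delta>\<rceil> \<le> x + \<delta>"
    by (simp_all add: distrib_left)
qed

text \<open>Two uses of \<open>(a + b)^2 \<le> 2 * a^2 + 2 * b^2\<close>; in between,
  \<open>\<delta> \<le> 1\<close> bounds the rounded value by |x| + 1 on the kept range.\<close>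

lemma ceil_trunc_square_le:
  assumes "0 < \<delta>" "\<delta> \<le> 1"
  shows "(ceil_trunc \<delta> n x - c)\<^sup>2 \<le> 4 * (x\<^sup>2 * of_bool (\<bar>x\<bar> \<le> real n)) + (4 + 2 * c\<^sup>2)"
proof -
  let ?t = "ceil_trunc \<delta> n x"
  have "(?t - c)\<^sup>2 \<le> 2 * ?t\<^sup>2 + 2 * c\<^sup>2"
    using zero_le_power2[of "?t + c"] by (simp add: power2_sum power2_diff)
  moreover have "?t\<^sup>2 \<le> 2 * (x\<^sup>2 * of_bool (\<bar>x\<bar> \<le> real n)) + 2"
  proof (cases "\<bar>x\<bar> \<le> real n")
    case True
    then have "\<bar>?t\<bar> \<le> \<bar>x\<bar> + 1"
      using ceil_bounds[OF assms(1), of x] assms(2) unfolding ceil_trunc_def by auto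
    then have "?t\<^sup>2 \<le> (\<bar>x\<bar> + 1)\<^sup>2" using power_mono[of "\<bar>?t\<bar>" "\<bar>x\<bar> + 1" 2] by simp
    also have "\<dots> \<le> 2 * x\<^sup>2 + 2"
      using zero_le_power2[of "\<bar>x\<bar> - 1"] by (simp add: power2_sum power2_diff)
    finally show ?thesis using True by simp
  qed (simp add: ceil_trunc_def)
  ultimately show ?thesis by simp
qed

text \<open>Terms from \<open>k\<close> on can only lower the sum. The bound is free of
  \<open>n\<close>, hence negligible after division by \<open>n\<close>.\<close>

lemma sum_le_of_eventually_nonpos:
  fixes h :: "nat \<Rightarrow> real"
  assumes "\<And>i. i \<ge> k \<Longrightarrow> h i \<le> 0"
  shows "(\<Sum>i<n. h i) \<le> (\<Sum>i<k. \<bar>h i\<bar>)"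
proof -
  have "(\<Sum>i<n. h i) \<le> (\<Sum>i<n. if i \<in> {..<k} then \<bar>h i\<bar> else 0)"
    using assms by (intro sum_mono) auto
  also have "\<dots> = (\<Sum>i\<in>{..<n} \<inter> {..<k}. \<bar>h i\<bar>)" by (simp add: sum.inter_restrict)
  also have "\<dots> \<le> (\<Sum>i<k. \<bar>h i\<bar>)" by (intro sum_mono2) auto
  finally show ?thesis .
qed

text \<open>Packaging the hypotheses as a locale allows reinterpretation with \<open>-X\<close>,
  which turns each upper bound into a lower one.\<close>

locale SL_iid = SL_space M F H E
  for M :: "'a measure" and F :: "nat \<Rightarrow> 'a measure" and H :: "('a \<Rightarrow> real) set"
    and E :: "nat \<Rightarrow> ('a \<Rightarrow> real) \<Rightarrow> ('a \<Rightarrow> real)" +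
  fixes X :: "nat \<Rightarrow> 'a \<Rightarrow> real"
  assumes X_in: "\<And>i. i \<ge> 1 \<Longrightarrow> X i \<in> Ht H F i"
    and X_indep: "\<And>i. i \<ge> 1 \<Longrightarrow> indep_of_Ft H F E (X i) (i - 1)"
    and X_ident: "\<And>i. i \<ge> 1 \<Longrightarrow> ident_distr H E (X i) (X 1)"
    and X_sum: "summable (\<lambda>m::nat. expect E (\<lambda>\<omega>. \<bar>X 1 \<omega>\<bar> *
                   indicator {\<omega>'. real m < \<bar>X 1 \<omega>'\<bar> \<and> \<bar>X 1 \<omega>'\<bar> \<le> real m + 1} \<omega>))"
begin

lemma X_Ht: "X (Suc i) \<in> Ht H F (Suc i)" by (rule X_in) simp

lemma X_H: "X (Suc i) \<in> H" by (rule Ht_H[OF X_Ht])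

lemma X_F: "X (Suc i) \<in> borel_measurable (F (Suc i))" by (rule Ht_measurable[OF X_Ht])

lemma X_M: "X (Suc i) \<in> borel_measurable M" by (rule H_measurable[OF X_H])

lemma X_indep_Suc: "indep_of_Ft H F E (X (Suc n)) n"
  using X_indep[of "Suc n"] by simp

lemma e_ident:
  assumes "\<And>j. (\<lambda>\<omega>. f (X (Suc j) \<omega>)) \<in> H"
  shows "e (\<lambda>\<omega>. f (X (Suc i) \<omega>)) = e (\<lambda>\<omega>. f (X 1 \<omega>))"
  using X_ident[of "Suc i"] assms[of i] assms[of 0] unfolding ident_distr_def by simp

lemma e_X: "e (X (Suc i)) = e (X 1)"
  using e_ident[of "\<lambda>x. x"] X_H by simp

lemma X1_H: "X 1 \<in> H" using X_H[of 0] by simp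

text \<open>The terms of the series in \<open>X_sum\<close>, with \<open>of_bool\<close> so that the
  integrand is visibly a function of the value of \<open>X 1\<close>.\<close>

definition p where "p m = e (\<lambda>\<omega>. \<bar>X 1 \<omega>\<bar> * of_bool (real m < \<bar>X 1 \<omega>\<bar> \<and> \<bar>X 1 \<omega>\<bar> \<le> real m + 1))"

lemma slice_set: "{\<omega>. real m < \<bar>X 1 \<omega>\<bar> \<and> \<bar>X 1 \<omega>\<bar> \<le> real m + 1} \<in> sets M"
proof -
  have [measurable]: "X 1 \<in> borel_measurable M" by (rule H_measurable[OF X1_H])
  have "{\<omega> \<in> space M. real m < \<bar>X 1 \<omega>\<bar> \<and> \<bar>X 1 \<omega>\<bar> \<le> real m + 1} \<in> sets M" by measurable
  then show ?thesis by simp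
qed

lemma slice_H: "(\<lambda>\<omega>. \<bar>X 1 \<omega>\<bar> * of_bool (real m < \<bar>X 1 \<omega>\<bar> \<and> \<bar>X 1 \<omega>\<bar> \<le> real m + 1)) \<in> H"
  using H_mult_indicator[OF H_abs[OF X1_H] slice_set[of m]] by (simp add: indicator_def)

lemma p_nonneg: "0 \<le> p m"
  unfolding p_def by (intro e_nonneg slice_H) simp

lemma p_summable: "summable p"
  using X_sum unfolding p_def[abs_def] indicator_def by simp

definition v where "v n = V {\<omega>. real n < \<bar>X 1 \<omega>\<bar>}"

lemma V_tail_ident: "V {\<omega>. c < \<bar>X (Suc i) \<omega>\<bar>} = V {\<omega>. c < \<bar>X 1 \<omega>\<bar>}"
proof -
  have "(\<lambda>\<omega>. of_bool (c < \<bar>X (Suc j) \<omega>\<bar>)) \<in> H" for j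
    using H_indicator[OF tail_set[OF X_H[of j], of c]] by (simp add: indicator_def[abs_def])
  from e_ident[of "\<lambda>x. of_bool (c < \<bar>x\<bar>)", OF this, of i]
  show ?thesis unfolding capacity_def by (simp add: indicator_def[abs_def])
qed

text \<open>Between levels \<open>n\<close> and \<open>n + 1\<close> the constant \<open>n\<close>
  is below |X 1|, so passing to the next level is paid for by one slice. This is the step of a
  summation by parts.\<close>

lemma v_step: "real n * v n \<le> real n * v (Suc n) + p n"
proof -
  have H1: "(\<lambda>\<omega>. real n * indicator {\<omega>. real (Suc n) < \<bar>X 1 \<omega>\<bar>} \<omega>) \<in> H"
    by (intro H_cmult H_indicator tail_set X1_H)
  have "real n * v n = e (\<lambda>\<omega>. real n * indicator {\<omega>. real n < \<bar>X 1 \<omega>\<bar>} \<omega>)"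
    unfolding v_def capacity_def by (intro e_cmult[symmetric] H_indicator tail_set X1_H) simp
  also have "\<dots> \<le> e (\<lambda>\<omega>. real n * indicator {\<omega>. real (Suc n) < \<bar>X 1 \<omega>\<bar>} \<omega> +
      \<bar>X 1 \<omega>\<bar> * of_bool (real n < \<bar>X 1 \<omega>\<bar> \<and> \<bar>X 1 \<omega>\<bar> \<le> real n + 1))"
    by (intro e_mono H_cmult H_add H_indicator tail_set X1_H slice_H) (auto simp: indicator_def)
  also have "\<dots> \<le> e (\<lambda>\<omega>. real n * indicator {\<omega>. real (Suc n) < \<bar>X 1 \<omega>\<bar>} \<omega>) + p n"
    unfolding p_def by (intro e_add H1 slice_H)
  also have "e (\<lambda>\<omega>. real n * indicator {\<omega>. real (Suc n) < \<bar>X 1 \<omega>\<bar>} \<omega>) = real n * v (Suc n)"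
    unfolding v_def capacity_def by (intro e_cmult H_indicator tail_set X1_H) simp
  finally show ?thesis .
qed

lemma v_nonneg: "0 \<le> v n"
  unfolding v_def by (intro V_nonneg tail_set X1_H)

text \<open>Summation by parts from \<open>v_step\<close>; the boundary term
  \<open>n * v (Suc n)\<close> is at most the expectation of |X 1| by Markov's inequality. Together
  with \<open>borel_cantelli\<close> this gives |X n| \<le> n eventually.\<close>

lemma summable_V_tail: "summable (\<lambda>n. V {\<omega>. real (Suc n) < \<bar>X (Suc n) \<omega>\<bar>})"
proof -
  have "summable (\<lambda>n. v (Suc n))"
  proof (rule summableI_nonneg_bounded)
    fix n
    have "(\<Sum>i<n. v (Suc i)) \<le> (\<Sum>i<n. p (Suc i)) + real n * v (Suc n)"
    proof (induction n)
      case (Suc n)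
      then show ?case using v_step[of "Suc n"] by (simp add: algebra_simps)
    qed simp
    moreover have "(\<Sum>i<n. p (Suc i)) \<le> (\<Sum>i. p (Suc i))"
      using p_nonneg p_summable by (intro sum_le_suminf) (auto simp: summable_Suc_iff)
    moreover have "real n * v (Suc n) \<le> e (\<lambda>\<omega>. \<bar>X 1 \<omega>\<bar>)"
    proof -
      have "real n * v (Suc n) = e (\<lambda>\<omega>. real n * indicator {\<omega>. real (Suc n) < \<bar>X 1 \<omega>\<bar>} \<omega>)"
        unfolding v_def capacity_def by (intro e_cmult[symmetric] H_indicator tail_set X1_H) simp
      also have "\<dots> \<le> e (\<lambda>\<omega>. \<bar>X 1 \<omega>\<bar>)"
        by (intro e_mono H_cmult H_indicator tail_set X1_H H_abs) (auto simp: indicator_def)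
      finally show ?thesis .
    qed
    ultimately show "(\<Sum>i<n. v (Suc i)) \<le> (\<Sum>i. p (Suc i)) + e (\<lambda>\<omega>. \<bar>X 1 \<omega>\<bar>)" by simp
  qed (rule v_nonneg)
  moreover have "V {\<omega>. real (Suc n) < \<bar>X (Suc n) \<omega>\<bar>} = v (Suc n)" for n
    unfolding v_def by (rule V_tail_ident)
  ultimately show ?thesis by (simp only:)
qed

lemma limsup_le:
  assumes \<delta>: "0 < \<delta>" "\<delta> \<le> 1"
  shows "quasi_surely M E (\<lambda>\<omega>. \<forall>\<^sub>F n in sequentially. (\<Sum>i<n. X (Suc i) \<omega>) \<le> (e (X 1) + 4 * \<delta>) * real n)"
proof -
  \<comment> \<open>The budget of \<open>4 * \<delta>\<close>: one part for rounding and one for the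
    truncation tail enter \<open>c\<close>, one is the slope used in
    \<open>upper_strong_law\<close>, and one absorbs the finitely many early terms.\<close>
  define c where "c = e (X 1) + 2 * \<delta>"
  have "\<forall>\<^sub>F n in sequentially. e (\<lambda>\<omega>. \<bar>X 1 \<omega>\<bar> * indicator {\<omega>. real n < \<bar>X 1 \<omega>\<bar>} \<omega>) < \<delta>"
    using tail_tendsto[OF X1_H] \<delta> by (auto dest!: order_tendstoD(2)[of _ _ _ \<delta>])
  then obtain k where k: "\<And>n. n \<ge> k \<Longrightarrow> e (\<lambda>\<omega>. \<bar>X 1 \<omega>\<bar> * indicator {\<omega>. real n < \<bar>X 1 \<omega>\<bar>} \<omega>) < \<delta>"
    by (auto simp: eventually_sequentially)
  define g where "g n x = ceil_trunc \<delta> n x - c" for n x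
  have g_meas: "g n \<in> borel_measurable borel" for n
    unfolding g_def[abs_def] using ceil_trunc_measurable[of \<delta> n] by (intro borel_measurable_diff borel_measurable_const)
  have g_fin: "finite (range (g n))" for n
    unfolding g_def[abs_def] using finite_range_comp[OF ceil_trunc_finite_range[OF \<delta>(1)], of "\<lambda>t. t - c" n] by simp
  have g_fin_X: "finite (range (\<lambda>\<omega>. g n (X j \<omega>)))" for n j
    by (rule finite_subset[OF _ g_fin[of n]]) auto
  have gX_H: "(\<lambda>\<omega>. g n (X (Suc j) \<omega>)) \<in> H" for n j
    by (intro H_finite_range measurable_compose[OF X_M g_meas] g_fin_X)
  have gX2_H: "(\<lambda>\<omega>. (g n (X (Suc j) \<omega>))\<^sup>2) \<in> H" for n j
    by (intro H_finite_range borel_measurable_power measurable_compose[OF X_M g_meas] finite_range_comp[OF g_fin_X])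
  have g_e: "e (\<lambda>\<omega>. g n (X (Suc j) \<omega>)) \<le> 0" if n: "n \<ge> k" for n j
  proof -
    have tH: "(\<lambda>\<omega>. \<bar>X 1 \<omega>\<bar> * indicator {\<omega>. real n < \<bar>X 1 \<omega>\<bar>} \<omega>) \<in> H"
      by (intro H_tail X1_H)
    have "e (\<lambda>\<omega>. g n (X (Suc j) \<omega>)) = e (\<lambda>\<omega>. g n (X 1 \<omega>))" by (rule e_ident[OF gX_H])
    also have "\<dots> \<le> e (\<lambda>\<omega>. (X 1 \<omega> + \<bar>X 1 \<omega>\<bar> * indicator {\<omega>. real n < \<bar>X 1 \<omega>\<bar>} \<omega>) + (\<delta> - c))"
    proof (intro e_mono H_add H_const tH X1_H)
      show "(\<lambda>\<omega>. g n (X 1 \<omega>)) \<in> H" using gX_H[of n 0] by simp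
      \<comment> \<open>Where truncation puts 0 in place of \<open>X 1\<close>, adding |X 1|
        compensates for negative values; elsewhere rounding costs at most
        \<open>\<delta>\<close>.\<close>
      fix \<omega> show "g n (X 1 \<omega>) \<le> (X 1 \<omega> + \<bar>X 1 \<omega>\<bar> * indicator {\<omega>. real n < \<bar>X 1 \<omega>\<bar>} \<omega>) + (\<delta> - c)"
        using ceil_bounds(2)[OF \<delta>(1), of "X 1 \<omega>"] \<delta> unfolding g_def ceil_trunc_def by (auto simp: indicator_def)
    qed
    also have "\<dots> = e (\<lambda>\<omega>. X 1 \<omega> + \<bar>X 1 \<omega>\<bar> * indicator {\<omega>. real n < \<bar>X 1 \<omega>\<bar>} \<omega>) + (\<delta> - c)"
      by (intro e_add_const H_add X1_H tH)
    also have "e (\<lambda>\<omega>. X 1 \<omega> + \<bar>X 1 \<omega>\<bar> * indicator {\<omega>. real n < \<bar>X 1 \<omega>\<bar>} \<omega>) \<le> e (X 1) + \<delta>"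
      using e_add[OF X1_H tH] k[OF n] by simp
    finally show ?thesis unfolding c_def by simp
  qed
  define B where "B = 4 + 2 * c\<^sup>2"
  have g2_e: "e (\<lambda>\<omega>. (g n (X (Suc j) \<omega>))\<^sup>2) \<le> 4 * (\<Sum>m<n. real (Suc m) * p m) + B" for n j
  proof -
    let ?s = "\<lambda>m \<omega>. \<bar>X 1 \<omega>\<bar> * of_bool (real m < \<bar>X 1 \<omega>\<bar> \<and> \<bar>X 1 \<omega>\<bar> \<le> real m + 1)"
    have sumH: "(\<lambda>\<omega>. \<Sum>m<n. real (Suc m) * ?s m \<omega>) \<in> H" by (intro H_sum H_cmult slice_H)
    have "e (\<lambda>\<omega>. (g n (X (Suc j) \<omega>))\<^sup>2) = e (\<lambda>\<omega>. (g n (X 1 \<omega>))\<^sup>2)"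
      by (rule e_ident[of "\<lambda>x. (g n x)\<^sup>2", OF gX2_H])
    also have "\<dots> \<le> e (\<lambda>\<omega>. 4 * (\<Sum>m<n. real (Suc m) * ?s m \<omega>) + B)"
    proof (intro e_mono H_add H_cmult sumH H_const)
      show "(\<lambda>\<omega>. (g n (X 1 \<omega>))\<^sup>2) \<in> H" using gX2_H[of n 0] by simp
      fix \<omega>
      have "(g n (X 1 \<omega>))\<^sup>2 \<le> 4 * ((X 1 \<omega>)\<^sup>2 * of_bool (\<bar>X 1 \<omega>\<bar> \<le> real n)) + B"
        unfolding g_def B_def by (rule ceil_trunc_square_le[OF \<delta>])
      also have "\<dots> \<le> 4 * (\<Sum>m<n. real (Suc m) * ?s m \<omega>) + B"
        using square_le_weighted_slices[of "X 1 \<omega>" n] by (intro add_right_mono mult_left_mono) auto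
      finally show "(g n (X 1 \<omega>))\<^sup>2 \<le> 4 * (\<Sum>m<n. real (Suc m) * ?s m \<omega>) + B" .
    qed
    also have "\<dots> = e (\<lambda>\<omega>. 4 * (\<Sum>m<n. real (Suc m) * ?s m \<omega>)) + B"
      by (intro e_add_const H_cmult sumH)
    also have "e (\<lambda>\<omega>. 4 * (\<Sum>m<n. real (Suc m) * ?s m \<omega>)) = 4 * e (\<lambda>\<omega>. \<Sum>m<n. real (Suc m) * ?s m \<omega>)"
      by (intro e_cmult sumH) simp
    also have "e (\<lambda>\<omega>. \<Sum>m<n. real (Suc m) * ?s m \<omega>) \<le> (\<Sum>m<n. e (\<lambda>\<omega>. real (Suc m) * ?s m \<omega>))"
      by (intro e_sum H_cmult slice_H) simp
    also have "\<dots> = (\<Sum>m<n. real (Suc m) * p m)"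
      unfolding p_def by (intro sum.cong refl e_cmult slice_H) simp
    finally show ?thesis by simp
  qed
  \<comment> \<open>Times up to \<open>k\<close> are zeroed, since the drift of \<open>g n\<close>
    is known to be nonpositive only for \<open>n \<ge> k\<close>; the drift condition then holds at
    every time.\<close>
  define W where "W n \<omega> = (if n \<ge> Suc k then g n (X n \<omega>) else 0)" for n \<omega>
  have W_cases: "W n = (if n \<ge> Suc k then (\<lambda>\<omega>. g n (X n \<omega>)) else (\<lambda>_. 0))" for n
    unfolding W_def by auto
  have X_F': "X n \<in> borel_measurable (F n)" if "n \<ge> Suc k" for n
    using X_F[of "n - 1"] that by simp
  have W_meas: "W n \<in> borel_measurable (F n)" for n
    unfolding W_cases using measurable_compose[OF X_F' g_meas, of n n] by simp
  have W_fin: "finite (range (W n))" for n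
    unfolding W_cases using g_fin_X by simp
  have W_neg: "e (\<lambda>\<omega>. a \<omega> * W (Suc n) \<omega>) \<le> 0"
    if "a \<in> borel_measurable (F n)" "finite (range a)" "\<And>\<omega>. 0 \<le> a \<omega>" for n a
  proof (cases "n \<ge> k")
    case True
    have "e (\<lambda>\<omega>. a \<omega> * g (Suc n) (X (Suc n) \<omega>)) \<le> 0"
      using True by (intro e_finite_range_mult_nonpos[OF X_indep_Suc g_meas gX_H g_e that]) simp
    with True show ?thesis unfolding W_def by simp
  qed (simp add: W_def)
  have W2_le: "e (\<lambda>\<omega>. (W (Suc i) \<omega>)\<^sup>2) \<le> 4 * (\<Sum>m<Suc i. real (Suc m) * p m) + B" for i
  proof (cases "i \<ge> k")
    case True
    then show ?thesis using g2_e[of "Suc i" i] unfolding W_def by simp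
  next
    case False
    have "0 \<le> (\<Sum>m<Suc i. real (Suc m) * p m)"
      using p_nonneg by (intro sum_nonneg) auto
    moreover have "0 \<le> B" unfolding B_def by simp
    ultimately show ?thesis using False unfolding W_def by simp
  qed
  have W2_nonneg: "0 \<le> e (\<lambda>\<omega>. (W n \<omega>)\<^sup>2)" for n
    by (intro e_nonneg H_finite_range borel_measurable_power measurable_F_M[OF W_meas]
        finite_range_comp[OF W_fin]) simp
  \<comment> \<open>The slices are summed by \<open>summable_weighted_partial_sums\<close>, the
    constant \<open>B\<close> by the series of inverse squares.\<close>
  have "summable (\<lambda>i. e (\<lambda>\<omega>. (W (Suc i) \<omega>)\<^sup>2) / (real (Suc i))\<^sup>2)"
  proof (rule summable_comparison_test')
    have "summable (\<lambda>i. 1 / (real (Suc i))\<^sup>2)"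
      using inverse_power_summable[of 2, where 'a = real]
      by (subst summable_Suc_iff) (simp add: inverse_eq_divide)
    from summable_add[OF summable_mult[OF summable_weighted_partial_sums[OF p_nonneg p_summable], of 4]
        summable_mult[OF this, of B]]
    show "summable (\<lambda>i. (4 * (\<Sum>m<Suc i. real (Suc m) * p m) + B) / (real (Suc i))\<^sup>2)"
      by (simp add: add_divide_distrib)
    fix i :: nat
    show "norm (e (\<lambda>\<omega>. (W (Suc i) \<omega>)\<^sup>2) / (real (Suc i))\<^sup>2)
      \<le> (4 * (\<Sum>m<Suc i. real (Suc m) * p m) + B) / (real (Suc i))\<^sup>2"
      using W2_nonneg[of "Suc i"] W2_le[of i] by (simp add: divide_right_mono)
  qed
  from upper_strong_law[OF W_meas W_fin _ this \<delta>(1)] W_neg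
  have "quasi_surely M E (\<lambda>\<omega>. \<forall>\<^sub>F n in sequentially. (\<Sum>i<n. W (Suc i) \<omega>) < \<delta> * real n)"
    by blast
  moreover have "quasi_surely M E (\<lambda>\<omega>. \<forall>\<^sub>F n in sequentially. \<omega> \<notin> {\<omega>. real (Suc n) < \<bar>X (Suc n) \<omega>\<bar>})"
    by (intro borel_cantelli tail_set X_H summable_V_tail)
  ultimately have "quasi_surely M E (\<lambda>\<omega>. (\<forall>\<^sub>F n in sequentially. (\<Sum>i<n. W (Suc i) \<omega>) < \<delta> * real n)
      \<and> (\<forall>\<^sub>F n in sequentially. \<omega> \<notin> {\<omega>. real (Suc n) < \<bar>X (Suc n) \<omega>\<bar>}))"
    by (rule qs_conj)
  then show ?thesis
  proof (rule qs_mp, elim conjE)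
    fix \<omega>
    assume ev1: "\<forall>\<^sub>F n in sequentially. (\<Sum>i<n. W (Suc i) \<omega>) < \<delta> * real n"
    assume "\<forall>\<^sub>F n in sequentially. \<omega> \<notin> {\<omega>. real (Suc n) < \<bar>X (Suc n) \<omega>\<bar>}"
    then obtain l where l: "\<And>n. n \<ge> l \<Longrightarrow> \<bar>X (Suc n) \<omega>\<bar> \<le> real (Suc n)"
      by (auto simp: eventually_sequentially not_less)
    \<comment> \<open>\<open>h\<close> is the error of replacing \<open>X (Suc i) - c\<close> by
      \<open>W (Suc i)\<close>. From \<open>max k l\<close> on truncation is inactive and rounding
      goes upward, so \<open>h\<close> is nonpositive.\<close>
    define h where "h i = X (Suc i) \<omega> - c - W (Suc i) \<omega>" for i
    define C where "C = (\<Sum>i<max k l. \<bar>h i\<bar>)"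
    have "h i \<le> 0" if "i \<ge> max k l" for i
      using that l[of i] ceil_bounds(1)[OF \<delta>(1), of "X (Suc i) \<omega>"]
      unfolding h_def W_def g_def ceil_trunc_def by simp
    then have sum_h: "(\<Sum>i<n. h i) \<le> C" for n unfolding C_def by (rule sum_le_of_eventually_nonpos)
    have "\<forall>\<^sub>F n in sequentially. C / \<delta> \<le> real n"
      using filterlim_real_sequentially unfolding filterlim_at_top by blast
    with ev1 show "\<forall>\<^sub>F n in sequentially. (\<Sum>i<n. X (Suc i) \<omega>) \<le> (e (X 1) + 4 * \<delta>) * real n"
    proof eventually_elim
      case (elim n)
      have "(\<Sum>i<n. X (Suc i) \<omega>) = (\<Sum>i<n. h i + W (Suc i) \<omega> + c)"
        unfolding h_def by simp
      also have "\<dots> = (\<Sum>i<n. h i) + (\<Sum>i<n. W (Suc i) \<omega>) + c * real n"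
        by (simp add: sum.distrib)
      also have "\<dots> \<le> \<delta> * real n + \<delta> * real n + c * real n"
        using sum_h[of n] elim \<delta> by (intro add_mono) (auto simp: field_simps)
      finally show ?case unfolding c_def by (simp add: algebra_simps)
    qed
  qed
qed

end

section \<open>Convergence in capacity, and reflection of the hypotheses\<close>

context SL_space
begin

text \<open>The tail unions decrease, and after removal of the exceptional set \<open>N\<close>
  their intersection is empty, so continuity from above applies.\<close>

lemma V_tendsto_0_of_qs:
  assumes A: "\<And>n. A n \<in> sets M"
    and qs: "quasi_surely M E (\<lambda>\<omega>. \<forall>\<^sub>F n in sequentially. \<omega> \<notin> A n)"
  shows "(\<lambda>n. V (A n)) \<longlonglongrightarrow> 0"
proof -
  from qs obtain N where N: "N \<in> sets M" "V N = 0"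
    and ev: "\<And>\<omega>. \<omega> \<notin> N \<Longrightarrow> \<forall>\<^sub>F n in sequentially. \<omega> \<notin> A n"
    unfolding quasi_surely_def by blast
  define B where "B n = (\<Union>m\<in>{n..}. A m) - N" for n
  have B: "B n \<in> sets M" for n unfolding B_def using A N by auto
  have B_lim: "(\<lambda>n. V (B n)) \<longlonglongrightarrow> 0"
  proof (rule V_decreasing[OF B])
    show "B (Suc n) \<subseteq> B n" for n unfolding B_def by (intro Diff_mono UN_mono) auto
    have False if x: "\<And>n. \<omega> \<in> B n" for \<omega>
    proof -
      have "\<omega> \<notin> N" using x[of 0] unfolding B_def by blast
      from ev[OF this] obtain k where k: "\<And>m. m \<ge> k \<Longrightarrow> \<omega> \<notin> A m"
        unfolding eventually_sequentially by blast
      with x[of k] show False unfolding B_def by auto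
    qed
    then show "(\<Inter>n. B n) = {}" by blast
  qed
  have A_le: "V (A n) \<le> V (B n)" for n
  proof -
    have "V (A n) \<le> V (B n \<union> N)"
      using A B N unfolding B_def by (intro V_mono sets.Un) auto
    also have "\<dots> \<le> V (B n) + V N" by (intro V_Un B N)
    finally show ?thesis using N by simp
  qed
  show ?thesis
  proof (rule tendsto_sandwich[OF _ _ tendsto_const B_lim])
    show "\<forall>\<^sub>F n in sequentially. 0 \<le> V (A n)" using V_nonneg[OF A] by simp
    show "\<forall>\<^sub>F n in sequentially. V (A n) \<le> V (B n)" using A_le by simp
  qed
qed

lemma indep_of_uminus:
  assumes "indep_of H E Y Z"
  shows "indep_of H E (\<lambda>\<omega>. - Y \<omega>) Z"
  unfolding indep_of_def
proof (intro allI impI)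
  fix \<phi> :: "real \<times> real \<Rightarrow> real"
  assume \<phi>: "\<phi> \<in> borel_measurable borel" "(\<lambda>\<omega>. \<phi> (Z \<omega>, - Y \<omega>)) \<in> H" "\<forall>z. (\<lambda>\<omega>. \<phi> (z, - Y \<omega>)) \<in> H"
  define \<psi> where "\<psi> = (\<lambda>x::real \<times> real. \<phi> (fst x, - snd x))"
  have "(\<lambda>x::real \<times> real. (fst x, - snd x)) \<in> borel_measurable borel"
    by (intro borel_measurable_continuous_onI continuous_intros)
  then have "\<psi> \<in> borel_measurable borel"
    unfolding \<psi>_def using \<phi>(1) by (rule measurable_compose)
  then have "e (\<lambda>\<omega>. \<psi> (Z \<omega>, Y \<omega>)) = e (\<lambda>\<omega>. e (\<lambda>\<omega>'. \<psi> (Z \<omega>, Y \<omega>')))"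
    using assms[unfolded indep_of_def, THEN spec, of \<psi>] \<phi>(2,3) unfolding \<psi>_def by simp
  then show "e (\<lambda>\<omega>. \<phi> (Z \<omega>, - Y \<omega>)) = e (\<lambda>\<omega>. e (\<lambda>\<omega>'. \<phi> (Z \<omega>, - Y \<omega>')))"
    by (simp add: \<psi>_def)
qed

lemma ident_distr_uminus:
  assumes "ident_distr H E Y Z"
  shows "ident_distr H E (\<lambda>\<omega>. - Y \<omega>) (\<lambda>\<omega>. - Z \<omega>)"
  unfolding ident_distr_def
proof (intro allI impI)
  fix \<phi> :: "real \<Rightarrow> real"
  assume "(\<lambda>\<omega>. \<phi> (- Y \<omega>)) \<in> H" "(\<lambda>\<omega>. \<phi> (- Z \<omega>)) \<in> H"
  then show "e (\<lambda>\<omega>. \<phi> (- Y \<omega>)) = e (\<lambda>\<omega>. \<phi> (- Z \<omega>))"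
    using assms[unfolded ident_distr_def, THEN spec, of "\<lambda>x. \<phi> (- x)"] by blast
qed

end

section \<open>Assertion (i), and superadditivity over independent increments\<close>

context SL_iid
begin

lemma SL_iid_uminus: "SL_iid M F H E (\<lambda>i \<omega>. - X i \<omega>)"
proof unfold_locales
  fix i :: nat assume i: "1 \<le> i"
  show "(\<lambda>\<omega>. - X i \<omega>) \<in> Ht H F i" by (intro Ht_uminus X_in i)
  show "indep_of_Ft H F E (\<lambda>\<omega>. - X i \<omega>) (i - 1)"
    using X_indep[OF i] indep_of_uminus unfolding indep_of_Ft_def by blast
  show "ident_distr H E (\<lambda>\<omega>. - X i \<omega>) (\<lambda>\<omega>. - X 1 \<omega>)" by (intro ident_distr_uminus X_ident i)
qed (use X_sum in simp)

text \<open>The countably many meshes \<open>1 / (k + 1)\<close> produce one null set that serves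
  all \<open>d > 0\<close>.\<close>

lemma limsup_average_le:
  "quasi_surely M E (\<lambda>\<omega>. \<forall>d>0. \<forall>\<^sub>F n in sequentially. (\<Sum>i<n. X (Suc i) \<omega>) / real n \<le> e (X 1) + d)"
proof -
  have "quasi_surely M E (\<lambda>\<omega>. \<forall>k::nat. \<forall>\<^sub>F n in sequentially.
      (\<Sum>i<n. X (Suc i) \<omega>) \<le> (e (X 1) + 4 * (1 / real (Suc k))) * real n)"
    by (intro qs_all limsup_le) auto
  then show ?thesis
  proof (rule qs_mp, intro allI impI)
    fix \<omega> and d :: real
    assume ev: "\<forall>k::nat. \<forall>\<^sub>F n in sequentially.
      (\<Sum>i<n. X (Suc i) \<omega>) \<le> (e (X 1) + 4 * (1 / real (Suc k))) * real n" and "d > 0"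
    then obtain k where k: "1 / real (Suc k) < d / 4"
      using nat_approx_posE[of "d / 4"] by auto
    show "\<forall>\<^sub>F n in sequentially. (\<Sum>i<n. X (Suc i) \<omega>) / real n \<le> e (X 1) + d"
      using ev[rule_format, of k] eventually_gt_at_top[of 0]
    proof eventually_elim
      case (elim n)
      then have "(\<Sum>i<n. X (Suc i) \<omega>) / real n \<le> e (X 1) + 4 * (1 / real (Suc k))"
        by (simp only: pos_divide_le_eq of_nat_0_less_iff)
      with k show ?case by simp
    qed
  qed
qed

text \<open>The one-sided law for \<open>-X\<close> bounds the averages from below by
  \<open>- e (\<lambda>\<omega>. - X 1 \<omega>)\<close>, which the hypothesis identifies with the
  upper bound.\<close>

lemma average_tendsto:
  assumes "e (X 1) = - e (\<lambda>\<omega>. - X 1 \<omega>)"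
  shows "quasi_surely M E (\<lambda>\<omega>. (\<lambda>n. (\<Sum>i<n. X (Suc i) \<omega>) / real n) \<longlonglongrightarrow> e (X 1))"
proof -
  interpret neg: SL_iid M F H E "\<lambda>i \<omega>. - X i \<omega>" by (rule SL_iid_uminus)
  from qs_conj[OF limsup_average_le neg.limsup_average_le] show ?thesis
  proof (rule qs_mp, elim conjE)
    fix \<omega>
    assume up: "\<forall>d>0. \<forall>\<^sub>F n in sequentially. (\<Sum>i<n. X (Suc i) \<omega>) / real n \<le> e (X 1) + d"
      and lo: "\<forall>d>0. \<forall>\<^sub>F n in sequentially. (\<Sum>i<n. - X (Suc i) \<omega>) / real n \<le> e (\<lambda>\<omega>. - X 1 \<omega>) + d"
    show "(\<lambda>n. (\<Sum>i<n. X (Suc i) \<omega>) / real n) \<longlonglongrightarrow> e (X 1)"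
    proof (rule tendstoI)
      fix d :: real assume "d > 0"
      then have d: "d / 2 > 0" by simp
      show "\<forall>\<^sub>F n in sequentially. dist ((\<Sum>i<n. X (Suc i) \<omega>) / real n) (e (X 1)) < d"
        using up[rule_format, OF d] lo[rule_format, OF d]
      proof eventually_elim
        case (elim n)
        then show ?case using assms d unfolding dist_real_def by (simp add: sum_negf)
      qed
    qed
  qed
qed

text \<open>Independence forces \<open>Y = E n (X (Suc n))\<close> to be at least
  \<open>\<mu> - d\<close> quasi-surely: on the set \<open>A\<close> in \<open>F n\<close> where
  this fails, independence gives the shifted variable restricted to \<open>A\<close> the expectation
  \<open>d * V A\<close>, while locality of \<open>E n\<close> makes it nonpositive. Subadditivity
  of \<open>E n\<close> then brings in \<open>Z\<close>.\<close>

lemma e_X_add_ge: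
  assumes Z: "Z \<in> Ht H F n"
  shows "e (X 1) + e Z \<le> e (\<lambda>\<omega>. X (Suc n) \<omega> + Z \<omega>)"
proof (rule field_le_epsilon)
  fix d :: real assume d: "d > 0"
  define \<mu> where "\<mu> = e (X 1)"
  have ZH: "Z \<in> H" by (rule Ht_H[OF Z])
  define Y where "Y = E n (X (Suc n))"
  have Y: "Y \<in> Ht H F n" unfolding Y_def by (rule E_Ht[OF X_H])
  define A where "A = {\<omega>. Y \<omega> < \<mu> - d}"
  have A: "A \<in> sets (F n)"
  proof -
    have [measurable]: "Y \<in> borel_measurable (F n)" by (rule Ht_measurable[OF Y])
    have "{\<omega> \<in> space (F n). Y \<omega> < \<mu> - d} \<in> sets (F n)" by measurable
    then show ?thesis unfolding A_def by simp
  qed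
  have AM: "A \<in> sets M" using A sets_F_subset by blast
  \<comment> \<open>The shift gives total expectation \<open>d > 0\<close>, yet its conditional
    expectation on \<open>A\<close> is at most \<open>Y + d - \<mu> < 0\<close>.\<close>
  define f :: "real \<Rightarrow> real" where "f y = y + (d - \<mu>)" for y
  have f_meas: "f \<in> borel_measurable borel" unfolding f_def[abs_def] by measurable
  have fX: "(\<lambda>\<omega>. f (X (Suc n) \<omega>)) \<in> H" unfolding f_def by (intro H_add X_H H_const)
  have e_fX: "e (\<lambda>\<omega>. f (X (Suc n) \<omega>)) = d"
    unfolding f_def using e_add_const[OF X_H[of n], of "d - \<mu>"] e_X[of n] \<mu>_def by simp
  have "d * V A = e (\<lambda>\<omega>. d * indicator A \<omega>)"
    unfolding capacity_def using d by (intro e_cmult[symmetric] H_indicator AM) simp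
  also have "\<dots> = e (\<lambda>\<omega>. indicator A \<omega> * f (X (Suc n) \<omega>))"
    unfolding indep_indicator[OF X_indep_Suc A f_meas fX] e_fX by (simp add: mult.commute)
  also have "\<dots> = e (E n (\<lambda>\<omega>. indicator A \<omega> * f (X (Suc n) \<omega>)))"
    by (intro e_E[symmetric] H_indicator_mult fX AM)
  also have "\<dots> = e (\<lambda>\<omega>. indicator A \<omega> * E n (\<lambda>\<omega>. f (X (Suc n) \<omega>)) \<omega>)"
    by (simp only: E_indicator[OF A fX])
  also have "\<dots> \<le> e (\<lambda>_. 0)"
  proof (intro e_mono H_indicator_mult AM H_const Ht_H[OF E_Ht] fX)
    fix \<omega>
    have "E n (\<lambda>\<omega>. f (X (Suc n) \<omega>)) \<omega> \<le> Y \<omega> + (d - \<mu>)"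
      using E_add[OF X_H[of n] H_const[of "d - \<mu>"], of n \<omega>] fun_cong[OF E_id[OF Ht_const[of "d - \<mu>" n]], of \<omega>]
      unfolding f_def Y_def by simp
    then show "indicator A \<omega> * E n (\<lambda>\<omega>. f (X (Suc n) \<omega>)) \<omega> \<le> 0"
      unfolding A_def by (auto simp: indicator_def)
  qed
  finally have "V A = 0" using d V_nonneg[OF AM] by (simp add: mult_le_0_iff)
  then have qs: "quasi_surely M E (\<lambda>\<omega>. \<mu> - d \<le> Y \<omega>)"
    unfolding quasi_surely_def using AM by (intro bexI[of _ A]) (auto simp: A_def)
  have XZ: "(\<lambda>\<omega>. X (Suc n) \<omega> + Z \<omega>) \<in> H" by (intro H_add X_H ZH)
  have "e Z + (\<mu> - d) = e (\<lambda>\<omega>. Z \<omega> + (\<mu> - d))" by (rule e_add_const[OF ZH, symmetric])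
  also have "\<dots> \<le> e (E n (\<lambda>\<omega>. X (Suc n) \<omega> + Z \<omega>))"
  proof (intro e_mono_qs H_add ZH H_const Ht_H[OF E_Ht] X_H qs_mp[OF qs])
    fix \<omega> assume "\<mu> - d \<le> Y \<omega>"
    \<comment> \<open>Subadditivity of \<open>E n\<close> for \<open>X (Suc n) + Z\<close> and
      \<open>-Z\<close>, the latter being fixed by \<open>E n\<close>.\<close>
    moreover have "Y \<omega> \<le> E n (\<lambda>\<omega>. X (Suc n) \<omega> + Z \<omega>) \<omega> - Z \<omega>"
      using E_add[OF XZ H_uminus[OF ZH], of n \<omega>] fun_cong[OF E_id[OF Ht_uminus[OF Z]], of \<omega>]
      unfolding Y_def by simp
    ultimately show "Z \<omega> + (\<mu> - d) \<le> E n (\<lambda>\<omega>. X (Suc n) \<omega> + Z \<omega>) \<omega>" by simp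
  qed
  also have "\<dots> = e (\<lambda>\<omega>. X (Suc n) \<omega> + Z \<omega>)" by (rule e_E[OF XZ])
  finally show "e (X 1) + e Z \<le> e (\<lambda>\<omega>. X (Suc n) \<omega> + Z \<omega>) + d" unfolding \<mu>_def by simp
qed

text \<open>Iterates \<open>e_X_add_ge\<close>: the sum built so far together with \<open>Z\<close>
  is known at time \<open>n + j\<close> and takes the place of \<open>Z\<close> for the next
  increment.\<close>

lemma e_sum_X_add_ge:
  assumes Z: "Z \<in> Ht H F n"
  shows "real j * e (X 1) + e Z \<le> e (\<lambda>\<omega>. (\<Sum>i<j. X (Suc (n + i)) \<omega>) + Z \<omega>)"
proof -
  have Ht: "(\<lambda>\<omega>. (\<Sum>i<j. X (Suc (n + i)) \<omega>) + Z \<omega>) \<in> Ht H F (n + j)" for j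
  proof (intro HtI H_add H_sum X_H Ht_H[OF Z] borel_measurable_add borel_measurable_sum)
    show "X (Suc (n + i)) \<in> borel_measurable (F (n + j))" if "i \<in> {..<j}" for i
      using that by (intro measurable_F_mono[OF X_F]) simp
    show "Z \<in> borel_measurable (F (n + j))"
      by (rule measurable_F_mono[OF Ht_measurable[OF Z]]) simp
  qed
  show ?thesis
  proof (induction j)
    case (Suc j)
    have "real (Suc j) * e (X 1) + e Z = e (X 1) + (real j * e (X 1) + e Z)"
      by (simp add: algebra_simps)
    also have "\<dots> \<le> e (X 1) + e (\<lambda>\<omega>. (\<Sum>i<j. X (Suc (n + i)) \<omega>) + Z \<omega>)"
      using Suc by simp
    also have "\<dots> \<le> e (\<lambda>\<omega>. X (Suc (n + j)) \<omega> + ((\<Sum>i<j. X (Suc (n + i)) \<omega>) + Z \<omega>))"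
      by (rule e_X_add_ge[OF Ht])
    also have "\<dots> = e (\<lambda>\<omega>. (\<Sum>i<Suc j. X (Suc (n + i)) \<omega>) + Z \<omega>)"
      by (simp add: algebra_simps)
    finally show ?case .
  qed simp
qed

section \<open>Limits of averages, and assertion (ii)\<close>

definition S where "S n \<omega> = (\<Sum>i<n. X (Suc i) \<omega>)"

lemma S_H: "S n \<in> H" unfolding S_def[abs_def] by (intro H_sum X_H)

text \<open>Off \<open>A n\<close> the difference is at most \<open>r\<close>. On \<open>A n\<close>
  it is at most the average of the |X i| plus |Xl|, and the common distribution makes all these
  restricted expectations small at the same \<open>n\<close>.\<close>

lemma e_abs_average_diff_tendsto:
  assumes Xl: "Xl \<in> H" and lim: "quasi_surely M E (\<lambda>\<omega>. (\<lambda>n. S n \<omega> / real n) \<longlonglongrightarrow> Xl \<omega>)"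
  shows "(\<lambda>n. e (\<lambda>\<omega>. \<bar>S n \<omega> / real n - Xl \<omega>\<bar>)) \<longlonglongrightarrow> 0"
proof (rule tendstoI)
  fix d :: real assume "d > 0"
  \<comment> \<open>Three contributions of \<open>r\<close> occur; a quarter of \<open>d\<close>
    leaves the final inequality strict.\<close>
  define r where "r = d / 4"
  have r: "r > 0" using \<open>d > 0\<close> unfolding r_def by simp
  define D where "D n \<omega> = S n \<omega> / real n - Xl \<omega>" for n \<omega>
  define A where "A n = {\<omega>. r < \<bar>D n \<omega>\<bar>}" for n
  have D_H: "D n \<in> H" for n unfolding D_def[abs_def] by (intro H_diff H_divide S_H Xl)
  have A: "A n \<in> sets M" for n unfolding A_def by (rule tail_set[OF D_H])
  have VA: "(\<lambda>n. V (A n)) \<longlonglongrightarrow> 0"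
  proof (rule V_tendsto_0_of_qs[OF A], rule qs_mp[OF lim])
    fix \<omega> assume "(\<lambda>n. S n \<omega> / real n) \<longlonglongrightarrow> Xl \<omega>"
    from tendstoD[OF this r] show "\<forall>\<^sub>F n in sequentially. \<omega> \<notin> A n"
      unfolding A_def D_def by (auto elim!: eventually_mono simp: dist_real_def)
  qed
  have tail: "e (\<lambda>\<omega>. \<bar>X (Suc i) \<omega>\<bar> * indicator {\<omega>. K < \<bar>X (Suc i) \<omega>\<bar>} \<omega>)
      = e (\<lambda>\<omega>. \<bar>X 1 \<omega>\<bar> * indicator {\<omega>. K < \<bar>X 1 \<omega>\<bar>} \<omega>)" for i K
  proof -
    have "(\<lambda>\<omega>. \<bar>X (Suc j) \<omega>\<bar> * of_bool (K < \<bar>X (Suc j) \<omega>\<bar>)) \<in> H" for j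
      using H_tail[OF X_H[of j], of K] by (simp add: indicator_def)
    from e_ident[of "\<lambda>x. \<bar>x\<bar> * of_bool (K < \<bar>x\<bar>)", OF this, of i]
    show ?thesis by (simp add: indicator_def)
  qed
  have "\<forall>\<^sub>F n in sequentially. \<forall>i\<in>UNIV. e (\<lambda>\<omega>. \<bar>X (Suc i) \<omega>\<bar> * indicator (A n) \<omega>) < r"
    by (rule uniform_abs_indicator_tendsto[OF X_H X1_H tail A VA r])
  moreover have "\<forall>\<^sub>F n in sequentially. \<forall>i\<in>UNIV::unit set. e (\<lambda>\<omega>. \<bar>Xl \<omega>\<bar> * indicator (A n) \<omega>) < r"
    by (rule uniform_abs_indicator_tendsto[OF Xl Xl refl A VA r])
  ultimately show "\<forall>\<^sub>F n in sequentially. dist (e (\<lambda>\<omega>. \<bar>S n \<omega> / real n - Xl \<omega>\<bar>)) 0 < d"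
    using eventually_gt_at_top[of 0]
  proof eventually_elim
    case (elim n)
    let ?I = "indicator (A n) :: 'a \<Rightarrow> real"
    have XI: "(\<lambda>\<omega>. \<bar>X (Suc i) \<omega>\<bar> * ?I \<omega>) \<in> H" for i by (intro H_mult_indicator H_abs X_H A)
    have XlI: "(\<lambda>\<omega>. \<bar>Xl \<omega>\<bar> * ?I \<omega>) \<in> H" by (intro H_mult_indicator H_abs Xl A)
    have sumI: "(\<lambda>\<omega>. \<Sum>i<n. \<bar>X (Suc i) \<omega>\<bar> * ?I \<omega>) \<in> H" by (intro H_sum XI)
    have "e (\<lambda>\<omega>. \<bar>D n \<omega>\<bar>) \<le> e (\<lambda>\<omega>. ((\<Sum>i<n. \<bar>X (Suc i) \<omega>\<bar> * ?I \<omega>) / real n + \<bar>Xl \<omega>\<bar> * ?I \<omega>) + r)"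
    proof (intro e_mono H_abs D_H H_add H_divide sumI XlI H_const)
      fix \<omega>
      show "\<bar>D n \<omega>\<bar> \<le> ((\<Sum>i<n. \<bar>X (Suc i) \<omega>\<bar> * ?I \<omega>) / real n + \<bar>Xl \<omega>\<bar> * ?I \<omega>) + r"
      proof (cases "\<omega> \<in> A n")
        case True
        have "\<bar>S n \<omega>\<bar> / real n \<le> (\<Sum>i<n. \<bar>X (Suc i) \<omega>\<bar>) / real n"
          unfolding S_def by (intro divide_right_mono sum_abs) simp
        moreover have "\<bar>D n \<omega>\<bar> \<le> \<bar>S n \<omega>\<bar> / real n + \<bar>Xl \<omega>\<bar>"
          unfolding D_def using abs_triangle_ineq4[of "S n \<omega> / real n" "Xl \<omega>"] by simp
        ultimately show ?thesis using True r by simp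
      next
        case False
        then show ?thesis unfolding A_def by simp
      qed
    qed
    also have "\<dots> = e (\<lambda>\<omega>. (\<Sum>i<n. \<bar>X (Suc i) \<omega>\<bar> * ?I \<omega>) / real n + \<bar>Xl \<omega>\<bar> * ?I \<omega>) + r"
      by (intro e_add_const H_add H_divide sumI XlI)
    also have "e (\<lambda>\<omega>. (\<Sum>i<n. \<bar>X (Suc i) \<omega>\<bar> * ?I \<omega>) / real n + \<bar>Xl \<omega>\<bar> * ?I \<omega>)
        \<le> e (\<lambda>\<omega>. (\<Sum>i<n. \<bar>X (Suc i) \<omega>\<bar> * ?I \<omega>) / real n) + e (\<lambda>\<omega>. \<bar>Xl \<omega>\<bar> * ?I \<omega>)"
      by (intro e_add H_divide sumI XlI)
    also have "e (\<lambda>\<omega>. (\<Sum>i<n. \<bar>X (Suc i) \<omega>\<bar> * ?I \<omega>) / real n) = e (\<lambda>\<omega>. \<Sum>i<n. \<bar>X (Suc i) \<omega>\<bar> * ?I \<omega>) / real n"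
      by (intro e_divide sumI) simp
    also have "\<dots> \<le> r"
    proof -
      have "e (\<lambda>\<omega>. \<Sum>i<n. \<bar>X (Suc i) \<omega>\<bar> * ?I \<omega>) \<le> (\<Sum>i<n. e (\<lambda>\<omega>. \<bar>X (Suc i) \<omega>\<bar> * ?I \<omega>))"
        by (intro e_sum XI) simp
      also have "\<dots> \<le> (\<Sum>i<n. r)" using elim(1) by (intro sum_mono) (simp add: less_imp_le)
      finally show ?thesis using elim(3) by (simp add: field_simps)
    qed
    also have "e (\<lambda>\<omega>. \<bar>Xl \<omega>\<bar> * ?I \<omega>) \<le> r" using elim(2) by (simp add: less_imp_le)
    finally have "e (\<lambda>\<omega>. \<bar>D n \<omega>\<bar>) \<le> r + r + r" by simp
    moreover have "0 \<le> e (\<lambda>\<omega>. \<bar>D n \<omega>\<bar>)" by (intro e_nonneg H_abs D_H) simp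
    ultimately show ?case using r unfolding D_def r_def by simp
  qed
qed

text \<open>Divides \<open>e_sum_X_add_ge\<close> by the total time \<open>n + j\<close> and lets
  \<open>j\<close> grow: the first \<open>n\<close> summands and the gap to the limit in mean
  vanish, and \<open>j / (n + j)\<close> tends to 1.\<close>

lemma e_limit_add_ge:
  assumes Xl: "Xl \<in> H" and lim: "quasi_surely M E (\<lambda>\<omega>. (\<lambda>n. S n \<omega> / real n) \<longlonglongrightarrow> Xl \<omega>)"
    and Z: "Z \<in> Ht H F n"
  shows "e (X 1) + e Z \<le> e (\<lambda>\<omega>. Xl \<omega> + Z \<omega>)"
proof -
  have ZH: "Z \<in> H" by (rule Ht_H[OF Z])
  define D where "D m \<omega> = \<bar>S m \<omega> / real m - Xl \<omega>\<bar>" for m \<omega>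
  have D_H: "D m \<in> H" for m unfolding D_def[abs_def] by (intro H_abs H_diff H_divide S_H Xl)
  have bound: "real j / real (n + j) * e (X 1) + e Z
      \<le> e (\<lambda>\<omega>. Xl \<omega> + Z \<omega>) + (e (D (n + j)) + e (\<lambda>\<omega>. \<bar>S n \<omega>\<bar>) / real (n + j))" if j: "j \<ge> 1" for j
  proof -
    let ?N = "real (n + j)"
    \<comment> \<open>\<open>Z\<close> is multiplied by the total time so that the division recovers
      it unchanged.\<close>
    let ?T = "\<lambda>\<omega>. (\<Sum>i<j. X (Suc (n + i)) \<omega>) + ?N * Z \<omega>"
    have N: "?N > 0" using j by simp
    have T_H: "?T \<in> H" by (intro H_add H_sum X_H H_cmult ZH)
    have S_split: "S (n + j) \<omega> = S n \<omega> + (\<Sum>i<j. X (Suc (n + i)) \<omega>)" for \<omega>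
      unfolding S_def by (induction j) simp_all
    have "real j * e (X 1) + ?N * e Z \<le> e ?T"
      using e_sum_X_add_ge[OF Ht_cmult[OF Z], of j ?N] e_cmult[OF ZH, of ?N] by simp
    then have "(real j * e (X 1) + ?N * e Z) / ?N \<le> e ?T / ?N"
      using N by (intro divide_right_mono) auto
    also have "(real j * e (X 1) + ?N * e Z) / ?N = real j / ?N * e (X 1) + e Z"
      using N by (simp add: field_simps)
    also have "e ?T / ?N = e (\<lambda>\<omega>. ?T \<omega> / ?N)" using N by (intro e_divide[symmetric] T_H) simp
    also have "\<dots> \<le> e (\<lambda>\<omega>. (Xl \<omega> + Z \<omega>) + (D (n + j) \<omega> + \<bar>S n \<omega>\<bar> / ?N))"
    proof (intro e_mono H_divide T_H H_add Xl ZH D_H H_abs S_H)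
      fix \<omega>
      have "?T \<omega> / ?N = S (n + j) \<omega> / ?N - S n \<omega> / ?N + Z \<omega>"
        using N unfolding S_split by (simp add: add_divide_distrib)
      moreover have "- (S n \<omega> / ?N) \<le> \<bar>S n \<omega>\<bar> / ?N"
        using divide_right_mono[of "- S n \<omega>" "\<bar>S n \<omega>\<bar>" ?N] by simp
      moreover have "S (n + j) \<omega> / ?N \<le> Xl \<omega> + D (n + j) \<omega>" unfolding D_def by linarith
      ultimately show "?T \<omega> / ?N \<le> (Xl \<omega> + Z \<omega>) + (D (n + j) \<omega> + \<bar>S n \<omega>\<bar> / ?N)" by linarith
    qed
    also have "\<dots> \<le> e (\<lambda>\<omega>. Xl \<omega> + Z \<omega>) + e (\<lambda>\<omega>. D (n + j) \<omega> + \<bar>S n \<omega>\<bar> / ?N)"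
      by (intro e_add H_add H_divide Xl ZH D_H H_abs S_H)
    also have "e (\<lambda>\<omega>. D (n + j) \<omega> + \<bar>S n \<omega>\<bar> / ?N) \<le> e (D (n + j)) + e (\<lambda>\<omega>. \<bar>S n \<omega>\<bar> / ?N)"
      by (intro e_add H_divide D_H H_abs S_H)
    also have "e (\<lambda>\<omega>. \<bar>S n \<omega>\<bar> / ?N) = e (\<lambda>\<omega>. \<bar>S n \<omega>\<bar>) / ?N"
      using N by (intro e_divide H_abs S_H) simp
    finally show ?thesis by simp
  qed
  have "(\<lambda>j. e (D (j + n))) \<longlonglongrightarrow> 0"
    using e_abs_average_diff_tendsto[OF Xl lim] unfolding D_def by (rule LIMSEQ_ignore_initial_segment)
  then have D_lim: "(\<lambda>j. e (D (n + j))) \<longlonglongrightarrow> 0" by (simp add: add.commute)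
  have N_lim: "filterlim (\<lambda>j. real (n + j)) at_top sequentially"
    by (rule filterlim_at_top_mono[OF filterlim_real_sequentially]) auto
  have "(\<lambda>j. 1 - real n / real (n + j)) \<longlonglongrightarrow> 1 - 0"
    by (intro tendsto_diff tendsto_const real_tendsto_divide_at_top[OF tendsto_const N_lim])
  moreover have "\<forall>\<^sub>F j in sequentially. 1 - real n / real (n + j) = real j / real (n + j)"
    using eventually_gt_at_top[of 0] by eventually_elim (simp add: field_simps)
  ultimately have "(\<lambda>j. real j / real (n + j)) \<longlonglongrightarrow> 1"
    by (auto intro: Lim_transform_eventually)
  from tendsto_add[OF tendsto_mult[OF this tendsto_const] tendsto_const]
  have lhs: "(\<lambda>j. real j / real (n + j) * e (X 1) + e Z) \<longlonglongrightarrow> 1 * e (X 1) + e Z" .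
  have rhs: "(\<lambda>j. e (\<lambda>\<omega>. Xl \<omega> + Z \<omega>) + (e (D (n + j)) + e (\<lambda>\<omega>. \<bar>S n \<omega>\<bar>) / real (n + j)))
      \<longlonglongrightarrow> e (\<lambda>\<omega>. Xl \<omega> + Z \<omega>) + (0 + 0)"
    by (intro tendsto_add tendsto_const D_lim real_tendsto_divide_at_top[OF tendsto_const N_lim])
  from LIMSEQ_le[OF lhs rhs] bound show ?thesis by auto
qed

text \<open>The indices \<open>i < n\<close> stand for the first \<open>n\<close> variables. The
  approximants from Assumption (A) are hence events of \<open>F n\<close>, and multiples of their
  indicators may serve as \<open>Z\<close>.\<close>

lemma gen_sigma_subset_F: "gen_sigma ((\<lambda>i. X (Suc i)) ` {..<n}) \<subseteq> sets (F n)"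
proof -
  have "sigma_sets (space (F n)) {Y -` B | Y B. Y \<in> (\<lambda>i. X (Suc i)) ` {..<n} \<and> B \<in> sets borel} \<subseteq> sets (F n)"
  proof (rule sets.sigma_sets_subset, safe)
    fix i and B :: "real set" assume i: "i < n" and B: "B \<in> sets borel"
    have "X (Suc i) \<in> borel_measurable (F n)" using i by (intro measurable_F_mono[OF X_F]) simp
    from measurable_sets[OF this B] show "X (Suc i) -` B \<in> sets (F n)" by simp
  qed
  then show ?thesis unfolding gen_sigma_def by simp
qed

text \<open>The event is phrased through the averages because \<open>Xl\<close> agrees with their
  limit only quasi-surely and is merely an element of \<open>H\<close>; in this form Assumption (A)
  applies to it.\<close>

lemma eventually_average_less_in_gen_sigma:
  "{\<omega>. \<exists>k. \<forall>n\<ge>k. S n \<omega> / real n < c} \<in> gen_sigma (range (\<lambda>i. X (Suc i)))"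
proof -
  define G where "G = sigma UNIV {Y -` B | Y B. Y \<in> range (\<lambda>i. X (Suc i)) \<and> B \<in> sets borel}"
  have sets_G: "sets G = gen_sigma (range (\<lambda>i. X (Suc i)))" and space_G: "space G = UNIV"
    unfolding G_def gen_sigma_def by (auto simp: sets_measure_of space_measure_of)
  have [measurable]: "X (Suc i) \<in> borel_measurable G" for i
  proof (rule measurableI)
    fix B :: "real set" assume "B \<in> sets borel"
    then show "X (Suc i) -` B \<inter> space G \<in> sets G"
      unfolding sets_G space_G gen_sigma_def by (auto intro!: sigma_sets.Basic)
  qed simp
  have "{\<omega> \<in> space G. \<exists>k. \<forall>n\<ge>k. S n \<omega> / real n < c} \<in> sets G"
    unfolding S_def by measurable
  then show ?thesis unfolding sets_G space_G by simp
qed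

lemma limit_eq_upper_expectation:
  assumes Xl: "Xl \<in> H" and lim: "quasi_surely M E (\<lambda>\<omega>. (\<lambda>n. S n \<omega> / real n) \<longlonglongrightarrow> Xl \<omega>)"
    and A: "assumption_A M E"
  shows "quasi_surely M E (\<lambda>\<omega>. Xl \<omega> = e (X 1))"
proof -
  define \<mu> where "\<mu> = e (X 1)"
  have le: "quasi_surely M E (\<lambda>\<omega>. (\<lambda>n. S n \<omega> / real n) \<longlonglongrightarrow> Xl \<omega> \<and> Xl \<omega> \<le> \<mu>)"
  proof (rule qs_mp[OF qs_conj[OF lim limsup_average_le]], elim conjE, intro conjI)
    fix \<omega>
    assume l: "(\<lambda>n. S n \<omega> / real n) \<longlonglongrightarrow> Xl \<omega>"
      and u: "\<forall>d>0. \<forall>\<^sub>F n in sequentially. (\<Sum>i<n. X (Suc i) \<omega>) / real n \<le> e (X 1) + d"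
    show "Xl \<omega> \<le> \<mu>"
    proof (rule field_le_epsilon)
      fix d :: real assume "d > 0"
      with u have "\<forall>\<^sub>F n in sequentially. S n \<omega> / real n \<le> \<mu> + d"
        unfolding S_def \<mu>_def by simp
      then show "Xl \<omega> \<le> \<mu> + d" by (rule tendsto_upperbound[OF l]) simp
    qed
  qed
  have ge: "quasi_surely M E (\<lambda>\<omega>. c \<le> Xl \<omega>)" if c: "c < \<mu>" for c
  proof -
    \<comment> \<open>Chosen so that \<open>c + K = \<mu>\<close>: on \<open>B\<close> the limit is
      quasi-surely at most \<open>c\<close>, so adding \<open>K\<close> there does not exceed
      \<open>\<mu>\<close>.\<close>
    define K where "K = \<mu> - c"
    have K: "K > 0" using c unfolding K_def by simp
    define B where "B = {\<omega>. \<exists>k. \<forall>n\<ge>k. S n \<omega> / real n < c}"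
    obtain Bs where Bs: "\<And>n. Bs n \<in> gen_sigma ((\<lambda>i. X (Suc i)) ` {..<n})"
      and Bs_lim: "(\<lambda>n. V ((Bs n - B) \<union> (B - Bs n))) \<longlonglongrightarrow> 0"
      using A[unfolded assumption_A_def, rule_format, of "\<lambda>i. X (Suc i)" B] X_M
        eventually_average_less_in_gen_sigma[of c] unfolding B_def by blast
    have BsF: "Bs n \<in> sets (F n)" for n using Bs gen_sigma_subset_F by blast
    have BsM: "Bs n \<in> sets M" for n using BsF sets_F_subset by blast
    have BM: "B \<in> sets M"
    proof -
      have [measurable]: "S n \<in> borel_measurable M" for n by (rule H_measurable[OF S_H])
      have "{\<omega> \<in> space M. \<exists>k. \<forall>n\<ge>k. S n \<omega> / real n < c} \<in> sets M" by measurable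
      then show ?thesis unfolding B_def by simp
    qed
    define R where "R n = (Bs n - B) \<union> (B - Bs n)" for n
    have RM: "R n \<in> sets M" for n unfolding R_def using BsM BM by auto
    have e_ind: "e (\<lambda>\<omega>. K * indicator C \<omega>) = K * V C" if "C \<in> sets M" for C
      unfolding capacity_def using K by (intro e_cmult H_indicator that) simp
    have XK: "(\<lambda>\<omega>. Xl \<omega> + K * indicator C \<omega>) \<in> H" if "C \<in> sets M" for C
      by (intro H_add Xl H_cmult H_indicator that)
    \<comment> \<open>The superadditive bound is available for \<open>Bs n\<close>, an event of
      \<open>F n\<close>. Exchanging \<open>Bs n\<close> for \<open>B\<close> costs
      \<open>K * V (R n)\<close> twice, once in the capacity and once in the expectation.\<close>
    have "\<mu> + K * V B \<le> e (\<lambda>\<omega>. Xl \<omega> + K * indicator B \<omega>) + 2 * K * V (R n)" for n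
    proof -
      have "V B \<le> V (Bs n \<union> R n)" by (intro V_mono BM sets.Un BsM RM) (auto simp: R_def)
      also have "\<dots> \<le> V (Bs n) + V (R n)" by (intro V_Un BsM RM)
      finally have "K * V B \<le> K * (V (Bs n) + V (R n))" using K by (intro mult_left_mono) auto
      moreover have "\<mu> + K * V (Bs n) \<le> e (\<lambda>\<omega>. Xl \<omega> + K * indicator (Bs n) \<omega>)"
        using e_limit_add_ge[OF Xl lim Ht_cmult[OF Ht_indicator[OF BsF]], of K n] e_ind[OF BsM[of n]]
        unfolding \<mu>_def by simp
      moreover have "e (\<lambda>\<omega>. Xl \<omega> + K * indicator (Bs n) \<omega>) \<le> e (\<lambda>\<omega>. (Xl \<omega> + K * indicator B \<omega>) + K * indicator (R n) \<omega>)"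
      proof (intro e_mono XK BsM H_add[OF XK] H_cmult H_indicator RM BM)
        fix \<omega> show "Xl \<omega> + K * indicator (Bs n) \<omega> \<le> (Xl \<omega> + K * indicator B \<omega>) + K * indicator (R n) \<omega>"
          using K unfolding R_def by (auto simp: indicator_def)
      qed
      moreover have "e (\<lambda>\<omega>. (Xl \<omega> + K * indicator B \<omega>) + K * indicator (R n) \<omega>)
          \<le> e (\<lambda>\<omega>. Xl \<omega> + K * indicator B \<omega>) + K * V (R n)"
        unfolding e_ind[OF RM, symmetric] by (intro e_add XK BM H_cmult H_indicator RM)
      ultimately show ?thesis by (simp add: algebra_simps)
    qed
    moreover have "(\<lambda>n. e (\<lambda>\<omega>. Xl \<omega> + K * indicator B \<omega>) + 2 * K * V (R n))
        \<longlonglongrightarrow> e (\<lambda>\<omega>. Xl \<omega> + K * indicator B \<omega>) + 2 * K * 0"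
      unfolding R_def by (intro tendsto_intros Bs_lim)
    ultimately have "\<mu> + K * V B \<le> e (\<lambda>\<omega>. Xl \<omega> + K * indicator B \<omega>)"
      using LIMSEQ_le_const by fastforce
    also have "\<dots> \<le> e (\<lambda>_. \<mu>)"
    proof (intro e_mono_qs XK BM H_const qs_mp[OF le], elim conjE)
      fix \<omega> assume l: "(\<lambda>n. S n \<omega> / real n) \<longlonglongrightarrow> Xl \<omega>" and u: "Xl \<omega> \<le> \<mu>"
      show "Xl \<omega> + K * indicator B \<omega> \<le> \<mu>"
      proof (cases "\<omega> \<in> B")
        case True
        then have "\<forall>\<^sub>F n in sequentially. S n \<omega> / real n \<le> c"
          unfolding B_def eventually_sequentially by (auto intro: less_imp_le)
        then have "Xl \<omega> \<le> c" by (rule tendsto_upperbound[OF l]) simp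
        with True show ?thesis unfolding K_def by simp
      qed (use u in simp)
    qed
    \<comment> \<open>The chain reads \<open>\<mu> + K * V B \<le> \<mu>\<close> with
      \<open>K > 0\<close>.\<close>
    finally have "V B = 0" using K V_nonneg[OF BM] by (simp add: mult_le_0_iff)
    then have "quasi_surely M E (\<lambda>\<omega>. \<omega> \<notin> B)" unfolding quasi_surely_def using BM by blast
    from qs_conj[OF this lim] show ?thesis
    proof (rule qs_mp, elim conjE)
      fix \<omega> assume nB: "\<omega> \<notin> B" and l: "(\<lambda>n. S n \<omega> / real n) \<longlonglongrightarrow> Xl \<omega>"
      show "c \<le> Xl \<omega>"
      proof (rule ccontr)
        assume "\<not> c \<le> Xl \<omega>"
        then have "\<forall>\<^sub>F n in sequentially. S n \<omega> / real n < c" using order_tendstoD(2)[OF l, of c] by simp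
        with nB show False unfolding B_def eventually_sequentially by simp
      qed
    qed
  qed
  have "quasi_surely M E (\<lambda>\<omega>. \<forall>k::nat. \<mu> - 1 / real (Suc k) \<le> Xl \<omega>)"
    by (intro qs_all ge) simp
  from qs_conj[OF this le] show ?thesis
  proof (rule qs_mp, elim conjE)
    fix \<omega> assume k: "\<forall>k::nat. \<mu> - 1 / real (Suc k) \<le> Xl \<omega>" and u: "Xl \<omega> \<le> \<mu>"
    have "\<mu> \<le> Xl \<omega>"
    proof (rule field_le_epsilon)
      fix d :: real assume "d > 0"
      then obtain m where "1 / real (Suc m) < d" by (rule nat_approx_posE)
      with k[rule_format, of m] show "\<mu> \<le> Xl \<omega> + d" by simp
    qed
    with u show "Xl \<omega> = e (X 1)" unfolding \<mu>_def by simp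
  qed
qed

text \<open>The limit is identified for \<open>X\<close> and, by reflection, for \<open>-X\<close>;
  both quasi-sure identities hold at a common point, where the two constants are compared.\<close>

lemma limit_unique_expectation:
  assumes Xl: "Xl \<in> H" and lim: "quasi_surely M E (\<lambda>\<omega>. (\<lambda>n. S n \<omega> / real n) \<longlonglongrightarrow> Xl \<omega>)"
    and A: "assumption_A M E"
  shows "e (X 1) = - e (\<lambda>\<omega>. - X 1 \<omega>)"
proof -
  interpret neg: SL_iid M F H E "\<lambda>i \<omega>. - X i \<omega>" by (rule SL_iid_uminus)
  have "quasi_surely M E (\<lambda>\<omega>. (\<lambda>n. neg.S n \<omega> / real n) \<longlonglongrightarrow> - Xl \<omega>)"
  proof (rule qs_mp[OF lim])
    fix \<omega> assume "(\<lambda>n. S n \<omega> / real n) \<longlonglongrightarrow> Xl \<omega>"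
    from tendsto_minus[OF this] show "(\<lambda>n. neg.S n \<omega> / real n) \<longlonglongrightarrow> - Xl \<omega>"
      unfolding S_def neg.S_def by (simp add: sum_negf)
  qed
  from qs_conj[OF limit_eq_upper_expectation[OF Xl lim A]
      neg.limit_eq_upper_expectation[OF H_uminus[OF Xl] this A]]
  obtain \<omega> where "Xl \<omega> = e (X 1)" "- Xl \<omega> = e (\<lambda>\<omega>. - X 1 \<omega>)" using qs_ex by blast
  then show ?thesis by simp
qed

end

section \<open>Both assertions for sums indexed from 1\<close>

theorem mainTheorem10:
  fixes M :: "'a measure" and F :: "nat \<Rightarrow> 'a measure" and H :: "('a \<Rightarrow> real) set"
    and E :: "nat \<Rightarrow> ('a \<Rightarrow> real) \<Rightarrow> ('a \<Rightarrow> real)" and X :: "nat \<Rightarrow> 'a \<Rightarrow> real"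
  assumes SL: "SL_expectation M F H E"
    and X_in: "\<And>i. i \<ge> 1 \<Longrightarrow> X i \<in> Ht H F i"
    and X_indep: "\<And>i. i \<ge> 1 \<Longrightarrow> indep_of_Ft H F E (X i) (i - 1)"
    and X_ident: "\<And>i. i \<ge> 1 \<Longrightarrow> ident_distr H E (X i) (X 1)"
    and X_sum: "summable (\<lambda>m::nat. expect E (\<lambda>\<omega>. \<bar>X 1 \<omega>\<bar> *
                   indicator {\<omega>'. real m < \<bar>X 1 \<omega>'\<bar> \<and> \<bar>X 1 \<omega>'\<bar> \<le> real m + 1} \<omega>))"
  shows "(expect E (X 1) = - expect E (\<lambda>\<omega>. - X 1 \<omega>) \<longrightarrow>
           quasi_surely M E (\<lambda>\<omega>. (\<lambda>n. (\<Sum>i\<in>{1..n}. X i \<omega>) / real n) \<longlonglongrightarrow> expect E (X 1)))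
       \<and> (\<forall>Xl\<in>H. quasi_surely M E (\<lambda>\<omega>. (\<lambda>n. (\<Sum>i\<in>{1..n}. X i \<omega>) / real n) \<longlonglongrightarrow> Xl \<omega>)
                  \<and> assumption_A M E \<longrightarrow>
           expect E (X 1) = - expect E (\<lambda>\<omega>. - X 1 \<omega>) \<and>
           quasi_surely M E (\<lambda>\<omega>. Xl \<omega> = expect E (X 1)))"
proof -
  interpret SL_iid M F H E X
    by unfold_locales (fact SL, fact X_in, fact X_indep, fact X_ident, fact X_sum)
  \<comment> \<open>The locale counts summands from 0 through \<open>X (Suc i)\<close>, so
    \<open>X 0\<close> never enters.\<close>
  have sum_eq: "(\<Sum>i\<in>{1..n}. X i \<omega>) = (\<Sum>i<n. X (Suc i) \<omega>)" for n \<omega>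
    using sum.atLeast1_atMost_eq[of "\<lambda>i. X i \<omega>" n] by simp
  show ?thesis
    unfolding sum_eq
    using average_tendsto limit_unique_expectation limit_eq_upper_expectation
    unfolding S_def by blast
qed

end
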